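(* Let $m\ge 2$ be an integer and let $X_1,X_2,\ldots,X_n,\ldots$ be a sequence of iid random variables drawn uniformly from the ordered finite alphabet $\mathcal{A}=\{\alpha_1<\alpha_2<\cdots<\alpha_m\}$. Let $LI_n$ be the length of the longest increasing subsequence of $X_1,\ldots,X_n$. Then, as $n\to\infty$, $$\frac{LI_n-n/m}{\sqrt{2n/m}}\ \Rightarrow\ -\frac1m\sum_{i=1}^{m-1} i\,\tilde B^i(1)+\max_{0\le t_1\le\cdots\le t_{m-1}\le 1}\ \sum_{i=1}^{m-1}\tilde B^i(t_i),$$ where $(\tilde B^1(t),\dots,\tilde B^{m-1}(t))$, $0\le t\le 1$, is an $(m-1)$-dimensional Brownian motion with covariance matrix $t\,M$, where $M$ is the tridiagonal $(m-1)\times(m-1)$ matrix with $M_{i,i}=1$, $M_{i,i+1}=M_{i+1,i}=-1/2$, and $M_{i,j}=0$ for $|i-j|\ge 2$.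
   Context: Increasing subsequences are understood in the weak (nondecreasing) sense: $LI_n$ is the largest $\ell$ for which there are indices $1\le i_1<\cdots<i_\ell\le n$ with $X_{i_1}\le X_{i_2}\le\cdots\le X_{i_\ell}$. The symbol $\Rightarrow$ denotes convergence in distribution. A $d$-dimensional Brownian motion is a linear transformation of a standard multidimensional Brownian motion (independent standard one-dimensional Brownian motions) on $[0,1]$ started at $0$; saying it has covariance matrix $tM$ means that it is a centered Gaussian process with continuous paths and stationary independent increments whose value at time $t$ has covariance matrix $tM$. *)

theory Defs
  imports "HOL-Probability.Probability"
begin

definition LI :: "(nat \<Rightarrow> 'c::linorder) \<Rightarrow> nat \<Rightarrow> nat" where
  "LI x n = Max {l. \<exists>s :: nat \<Rightarrow> nat.
     strict_mono_on {1..l} s \<and> s ` {1..l} \<subseteq> {1..n} \<and> mono_on {1..l} (x \<circ> s)}"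

text \<open>The set in the definition of \<^const>\<open>LI\<close> is finite and nonempty, so \<^const>\<open>Max\<close> is a genuine maximum.\<close>

lemma LI_candidates:
  fixes x :: "nat \<Rightarrow> 'c::linorder"
  defines "L n \<equiv> {l. \<exists>s :: nat \<Rightarrow> nat.
     strict_mono_on {1..l} s \<and> s ` {1..l} \<subseteq> {1..n} \<and> mono_on {1..l} (x \<circ> s)}"
  shows "finite (L n)" and "L n \<noteq> {}"
proof -
  have "l \<le> n" if "l \<in> L n" for l
  proof -
    from that obtain s :: "nat \<Rightarrow> nat" where s: "strict_mono_on {1..l} s" "s ` {1..l} \<subseteq> {1..n}"
      unfolding L_def by blast
    have "inj_on s {1..l}"
      using s(1) by (rule strict_mono_on_imp_inj_on)
    then show ?thesis
      using card_inj_on_le[OF _ s(2)] by simp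
  qed
  then show "finite (L n)"
    by (meson finite_nat_set_iff_bounded_le)
  have "0 \<in> L n"
    by (simp add: L_def monotone_on_def)
  then show "L n \<noteq> {}"
    by blast
qed

text \<open>The normal law with mean \<open>\<mu>\<close> and standard deviation \<open>\<sigma>\<close>; for \<open>\<sigma> = 0\<close> it is the point mass
  at \<open>\<mu>\<close>, where \<^const>\<open>normal_density\<close> is not a density.\<close>

definition normal_law :: "real \<Rightarrow> real \<Rightarrow> real measure" where
  "normal_law \<mu> \<sigma> = (if \<sigma> = 0 then return borel \<mu> else density lborel (normal_density \<mu> \<sigma>))"

text \<open>A \<open>d\<close>-dimensional Brownian motion on \<open>[0,1]\<close> with covariance matrix \<open>t M\<close>: \<open>B i t\<close> is the
  \<open>i\<close>-th coordinate at time \<open>t\<close>, for \<open>1 \<le> i \<le> d\<close> and \<open>0 \<le> t \<le> 1\<close>; values at other indices are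
  irrelevant. Being Gaussian means that all finite linear combinations of the \<open>B i t\<close> are normal,
  so their second moments exist and, as the process is centered, \<open>E (B i t * B j t)\<close> is the
  covariance.\<close>

locale brownian_motion = prob_space N for N :: "'b measure" +
  fixes d :: nat
    and M :: "nat \<Rightarrow> nat \<Rightarrow> real"
    and B :: "nat \<Rightarrow> real \<Rightarrow> 'b \<Rightarrow> real"
  assumes random_variable [measurable]:
      "\<And>i t. i \<in> {1..d} \<Longrightarrow> t \<in> {0..1} \<Longrightarrow> random_variable borel (B i t)"
    and start: "\<And>i \<omega>. i \<in> {1..d} \<Longrightarrow> \<omega> \<in> space N \<Longrightarrow> B i 0 \<omega> = 0"
    and continuous_paths:
      "\<And>i \<omega>. i \<in> {1..d} \<Longrightarrow> \<omega> \<in> space N \<Longrightarrow> continuous_on {0..1} (\<lambda>t. B i t \<omega>)"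
    and gaussian:
      "\<And>F c. finite F \<Longrightarrow> F \<subseteq> {1..d} \<times> {0..1} \<Longrightarrow>
         \<exists>\<mu> \<sigma>. \<sigma> \<ge> 0 \<and>
           distr N borel (\<lambda>\<omega>. \<Sum>(i, t)\<in>F. c (i, t) * B i t \<omega>) = normal_law \<mu> \<sigma>"
    and centered: "\<And>i t. i \<in> {1..d} \<Longrightarrow> t \<in> {0..1} \<Longrightarrow> expectation (B i t) = 0"
    and covariance:
      "\<And>i j t. i \<in> {1..d} \<Longrightarrow> j \<in> {1..d} \<Longrightarrow> t \<in> {0..1} \<Longrightarrow>
         expectation (\<lambda>\<omega>. B i t \<omega> * B j t \<omega>) = t * M i j"
    and independent_increments:
      "\<And>(k :: nat) t. mono_on {0..k} t \<Longrightarrow> t ` {0..k} \<subseteq> {0..1} \<Longrightarrow>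
         indep_vars (\<lambda>_. PiM {1..d} (\<lambda>_. borel))
           (\<lambda>l \<omega>. \<lambda>i\<in>{1..d}. B i (t (Suc l)) \<omega> - B i (t l) \<omega>) {..<k}"
    and stationary_increments:
      "\<And>s h. 0 \<le> s \<Longrightarrow> 0 \<le> h \<Longrightarrow> s + h \<le> 1 \<Longrightarrow>
         distr N (PiM {1..d} (\<lambda>_. borel)) (\<lambda>\<omega>. \<lambda>i\<in>{1..d}. B i (s + h) \<omega> - B i s \<omega>) =
         distr N (PiM {1..d} (\<lambda>_. borel)) (\<lambda>\<omega>. \<lambda>i\<in>{1..d}. B i h \<omega> - B i 0 \<omega>)"

definition tridiag :: "nat \<Rightarrow> nat \<Rightarrow> real" where
  "tridiag i j = (if i = j then 1 else if j = i + 1 \<or> i = j + 1 then - 1 / 2 else 0)"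

definition ordered_times :: "nat \<Rightarrow> (nat \<Rightarrow> real) set" where
  "ordered_times d = {t \<in> {1..d} \<rightarrow> {0..1}. mono_on {1..d} t}"

text \<open>For continuous paths the supremum over \<^const>\<open>ordered_times\<close> is attained, hence it is the
  maximum over \<open>0 \<le> t\<^sub>1 \<le> \<dots> \<le> t\<^sub>d \<le> 1\<close>.\<close>

lemma SUP_ordered_times_attained:
  fixes f :: "nat \<Rightarrow> real \<Rightarrow> real"
  assumes cont: "\<And>i. i \<in> {1..d} \<Longrightarrow> continuous_on {0..1} (f i)"
  shows "\<exists>t\<in>ordered_times d. (\<Sum>i=1..d. f i (t i)) = (SUP t\<in>ordered_times d. \<Sum>i=1..d. f i (t i)) \<and>
    (\<forall>u\<in>ordered_times d. (\<Sum>i=1..d. f i (u i)) \<le> (\<Sum>i=1..d. f i (t i)))"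
proof -
  let ?g = "\<lambda>t. \<Sum>i=1..d. f i (t i)"
  define P where "P = PiE {1..d} (\<lambda>_. {0..1::real})"
  define K where "K = P \<inter> ordered_times d"
  have "compactin (product_topology (\<lambda>_. euclidean) UNIV)
      (PiE UNIV (\<lambda>i. if i \<in> {1..d} then {0..1::real} else {undefined}))"
    by (subst compactin_PiE) auto
  moreover have "PiE UNIV (\<lambda>i. if i \<in> {1..d} then {0..1::real} else {undefined}) = P"
    unfolding P_def by (auto simp: PiE_def Pi_def extensional_def split: if_splits)
  ultimately have "compact P"
    by (simp add: euclidean_product_topology)
  moreover have "K = P \<inter> (\<Inter>i\<in>{1..d}. \<Inter>j\<in>{i..d}. {t. t i \<le> t j})"
    unfolding K_def ordered_times_def P_def by (force simp: monotone_on_def)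
  moreover have "closed {t :: nat \<Rightarrow> real. t i \<le> t j}" for i j
    by (intro closed_Collect_le continuous_on_product_coordinates)
  ultimately have "compact K"
    by (auto intro!: compact_Int_closed closed_INT)
  moreover have "(\<lambda>i. if i \<in> {1..d} then 0 else undefined) \<in> K"
    unfolding K_def P_def ordered_times_def by (auto simp: monotone_on_def)
  then have "K \<noteq> {}"
    by blast
  moreover have "continuous_on K ?g"
  proof (rule continuous_on_sum)
    fix i assume i: "i \<in> {1..d}"
    show "continuous_on K (\<lambda>t. f i (t i))"
      by (rule continuous_on_compose2[OF cont[OF i]])
        (use i in \<open>auto simp: K_def P_def intro!: continuous_on_subset[OF continuous_on_product_coordinates]\<close>)
  qed
  ultimately obtain t where t: "t \<in> K" "\<forall>u\<in>K. ?g u \<le> ?g t"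
    using continuous_attains_sup by blast
  have le: "?g u \<le> ?g t" if u: "u \<in> ordered_times d" for u
  proof -
    have "restrict u {1..d} \<in> K"
      using u unfolding K_def P_def ordered_times_def by (auto simp: monotone_on_def)
    then have "?g (restrict u {1..d}) \<le> ?g t"
      using t by blast
    then show ?thesis by simp
  qed
  have "t \<in> ordered_times d"
    using t(1) by (simp add: K_def)
  moreover from this le have "(SUP t\<in>ordered_times d. ?g t) = ?g t"
    by (intro cSup_eq_maximum) auto
  ultimately show ?thesis
    using le by metis
qed

end

theory Submission
  imports Defs "HOL-Real_Asymp.Real_Asymp"
begin

text \<open>
  An increasing subsequence reads first letters \<open>\<alpha>\<^sub>1\<close>, then letters \<open>\<alpha>\<^sub>2\<close>, and so on. It is optimal to
  choose positions \<open>0 \<le> k\<^sub>1 \<le> \<dots> \<le> k\<^sub>m\<^sub>-\<^sub>1 \<le> n\<close> for the changes of letter and to take all the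
  letters \<open>\<alpha>\<^sub>r\<close> between \<open>k\<^sub>r\<^sub>-\<^sub>1\<close> and \<open>k\<^sub>r\<close>. In terms of the random walks
  \<open>S\<^sub>r(k) = #{i \<le> k. X\<^sub>i = \<alpha>\<^sub>r} - #{i \<le> k. X\<^sub>i = \<alpha>\<^sub>r\<^sub>+\<^sub>1}\<close> this gives the exact identity
  \<open>LI\<^sub>n - n/m = - (1/m) \<Sum>\<^sub>r r S\<^sub>r(n) + max\<^sub>k \<Sum>\<^sub>r S\<^sub>r(k\<^sub>r)\<close>
  (lemma \<open>LI_eq_max_value\<close>). The right-hand side is the functional of the limit law applied to the
  walk, and a single step of the walk has mean zero and covariance \<open>(2/m) M\<close>. After division by
  \<open>sqrt (2n/m)\<close> the steps have the same first and second moments as the increments of the Brownian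
  motion over intervals of length \<open>1/n\<close>.

  What remains is that the law of the maximum depends on the step law only through these two moments,
  as \<open>n\<close> tends to infinity. The maximum over paths is replaced by the smooth function
  \<open>(1/\<beta>) ln (\<Sum>\<^sub>k exp (\<beta> L\<^sub>k))\<close>, where \<open>L\<^sub>k\<close> is the value of the path \<open>k\<close>. This changes it by at most
  \<open>ln (number of paths) / \<beta> = O(ln n / \<beta>)\<close> (lemma \<open>soft_value_bounds\<close>). In each single step, its
  derivatives are cumulants of a probability measure on the paths; they are bounded by powers of \<open>\<beta>\<close>
  and do not grow with the number of paths (lemmas \<open>cos_ln_tilted_sum_taylor\<close> and
  \<open>cos_log_sum_exp_taylor\<close>). Following Lindeberg, the letter steps are exchanged for Brownian increments
  one at a time (lemma \<open>lindeberg_replacement\<close>). The first two orders of the Taylor expansion agree, so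
  each exchange costs \<open>O(\<beta>\<^sup>2 n\<^bsup>-3/2\<^esup>)\<close>, and \<open>\<beta> = n\<^bsup>1/8\<^esup>\<close> sends the total error to zero (lemma
  \<open>max_value_comparison_tendsto\<close>). The test functions are \<open>v \<mapsto> cos (u v + \<theta>)\<close>, so the conclusion is the
  convergence of characteristic functions.

  For the Brownian increments the maximum runs over times in the mesh \<open>{0, 1/n, \<dots>, 1}\<close>, and it converges
  pointwise to the supremum over all ordered times, as the sample paths are continuous (lemma
  \<open>max_value_increments_tendsto\<close>). Dominated convergence and Levy's continuity theorem finish the proof.
\<close>

section \<open>Increasing subsequences as maximal paths\<close>

text \<open>A path is the vector of the positions at which the letter being read changes: the letter \<open>r\<close> is
  read at the positions \<open>k (r - 1) + 1, \<dots>, k r\<close>, where \<open>k 0 = 0\<close> and \<open>k (d + 1) = n\<close>.\<close>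

definition paths :: "nat \<Rightarrow> nat \<Rightarrow> (nat \<Rightarrow> nat) set" where
  "paths d n = {k \<in> {1..d} \<rightarrow>\<^sub>E {0..n}. mono_on {1..d} k}"

text \<open>Steps are numbered from \<open>0\<close>, so that step \<open>l\<close> belongs to position \<open>l + 1\<close>. Subtracting
  \<open>r / (d + 1)\<close> puts the correction \<open>- (1 / m) \<Sum>\<^sub>r r x\<^sub>r\<close> of the limit law into every path, which makes
  the whole functional a maximum of linear functionals with coefficients in \<open>[-1, 1]\<close>.\<close>

definition path_coeff :: "nat \<Rightarrow> (nat \<Rightarrow> nat) \<Rightarrow> nat \<Rightarrow> nat \<Rightarrow> real" where
  "path_coeff d k l r = of_bool (l < k r) - real r / real (d + 1)"

definition path_value :: "nat \<Rightarrow> nat \<Rightarrow> (nat \<Rightarrow> nat) \<Rightarrow> (nat \<Rightarrow> nat \<Rightarrow> real) \<Rightarrow> real" where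
  "path_value d n k x = (\<Sum>l<n. \<Sum>r=1..d. path_coeff d k l r * x l r)"

definition max_value :: "nat \<Rightarrow> nat \<Rightarrow> (nat \<Rightarrow> nat \<Rightarrow> real) \<Rightarrow> real" where
  "max_value d n x = Max ((\<lambda>k. path_value d n k x) ` paths d n)"

lemma finite_paths [simp]: "finite (paths d n)"
  unfolding paths_def by (rule finite_subset[OF _ finite_PiE[of "{1..d}" "\<lambda>_. {0..n}"]]) auto

lemma paths_nonempty [simp]: "paths d n \<noteq> {}"
proof -
  have "(\<lambda>i\<in>{1..d}. 0) \<in> paths d n"
    by (auto simp: paths_def monotone_on_def)
  then show ?thesis by blast
qed

lemma card_paths_le: "card (paths d n) \<le> (n + 1) ^ d"
proof -
  have "card (paths d n) \<le> card ({1..d} \<rightarrow>\<^sub>E {0..n})"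
    by (rule card_mono) (auto simp: paths_def intro: finite_PiE)
  also have "\<dots> = (n + 1) ^ d"
    by (simp add: card_PiE)
  finally show ?thesis .
qed

lemma initial_segment_eq:
  fixes S :: "nat set"
  assumes "S \<subseteq> {1..d}" and down: "\<And>i j. i \<in> S \<Longrightarrow> 1 \<le> j \<Longrightarrow> j \<le> i \<Longrightarrow> j \<in> S"
  shows "S = {1..card S}"
proof (cases "S = {}")
  case False
  have fin: "finite S" using assms(1) by (rule finite_subset) simp
  have "S = {1..Max S}"
  proof (intro set_eqI iffI)
    show "j \<in> {1..Max S}" if "j \<in> S" for j
      using that assms(1) fin by auto
    show "j \<in> S" if "j \<in> {1..Max S}" for j
      using that down[OF Max_in[OF fin False], of j] by auto
  qed
  moreover from this have "card S = Max S"
    by (metis card_atLeastAtMost diff_Suc_1)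
  ultimately show ?thesis by simp
qed simp

text \<open>The letter read at position \<open>l + 1\<close>, when position \<open>k r\<close> is the last one before the change
  from letter \<open>r\<close> to letter \<open>r + 1\<close>.\<close>

definition letter_at :: "nat \<Rightarrow> (nat \<Rightarrow> nat) \<Rightarrow> nat \<Rightarrow> nat" where
  "letter_at d k l = Suc (card {r \<in> {1..d}. k r \<le> l})"

lemma letter_at_le: "letter_at d k l \<le> d + 1"
proof -
  have "card {r \<in> {1..d}. k r \<le> l} \<le> card {1..d}"
    by (rule card_mono) auto
  then show ?thesis by (simp add: letter_at_def)
qed

lemma letter_at_mono: "l \<le> l' \<Longrightarrow> letter_at d k l \<le> letter_at d k l'"
  unfolding letter_at_def Suc_le_mono by (rule card_mono) auto

lemma letter_at_le_iff:
  assumes "mono_on {1..d} k" "r \<in> {1..d}"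
  shows "letter_at d k l \<le> r \<longleftrightarrow> l < k r"
proof -
  let ?S = "{r \<in> {1..d}. k r \<le> l}"
  have "?S = {1..card ?S}"
  proof (rule initial_segment_eq)
    fix i j assume i: "i \<in> ?S" and j: "1 \<le> j" "j \<le> i"
    then have "k j \<le> k i"
      using mono_onD[OF assms(1), of j i] by simp
    then show "j \<in> ?S" using i j by simp
  qed auto
  from arg_cong[OF this, of "\<lambda>A. r \<in> A"] have "r \<in> ?S \<longleftrightarrow> r \<le> card ?S"
    using assms(2) by (simp only: atLeastAtMost_iff) auto
  then show ?thesis
    using assms(2) by (auto simp: letter_at_def not_le)
qed

text \<open>The differences telescope over \<open>r \<ge> p\<close> to the indicator of \<open>y = p\<close> minus that of \<open>y = d + 1\<close>,
  and the weights \<open>r / (d + 1)\<close> put back the indicator of \<open>y = d + 1\<close>, less \<open>1 / (d + 1)\<close>.\<close>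

lemma letter_indicator_eq:
  assumes y: "y \<in> {1..d + 1}" and p: "p \<in> {1..d + 1}"
  shows "(\<Sum>r=1..d. (of_bool (p \<le> r) - real r / real (d + 1)) * (of_bool (y = r) - of_bool (y = Suc r)))
    = (of_bool (y = p) :: real) - 1 / real (d + 1)"
proof -
  let ?c = "\<lambda>r. of_bool (p \<le> r) - real r / real (d + 1) :: real"
  have 1: "(\<Sum>r=1..d. ?c r * of_bool (y = r)) = (if y \<le> d then ?c y else 0)"
    using y by (simp add: of_bool_def if_distrib[of "\<lambda>x. _ * x"] cong: if_cong)
  have "(\<Sum>r=1..d. ?c r * of_bool (y = Suc r)) = (\<Sum>r=1..d. if r = y - 1 then ?c r else 0)"
    using y by (intro sum.cong) auto
  also have "\<dots> = (if y \<ge> 2 then ?c (y - 1) else 0)"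
    using y by auto
  finally have 2: "(\<Sum>r=1..d. ?c r * of_bool (y = Suc r)) = (if y \<ge> 2 then ?c (y - 1) else 0)" .
  have "(\<Sum>r=1..d. ?c r * (of_bool (y = r) - of_bool (y = Suc r)))
      = (if y \<le> d then ?c y else 0) - (if y \<ge> 2 then ?c (y - 1) else 0)"
    by (simp only: right_diff_distrib sum_subtractf 1 2)
  also have "\<dots> = of_bool (y = p) - 1 / real (d + 1)"
  proof -
    have last: "real d / real (d + 1) = 1 - 1 / real (d + 1)"
      by (simp add: field_simps)
    have step: "real (y - 1) / real (d + 1) = real y / real (d + 1) - 1 / real (d + 1)"
      using y by (simp add: of_nat_diff diff_divide_distrib)
    consider "2 \<le> y" "y \<le> d" | "y = 1" "1 \<le> d" | "y = d + 1" "1 \<le> d" | "y = 1" "d = 0"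
      using y by fastforce
    then show ?thesis
    proof cases
      case 1
      then have "(of_bool (p \<le> y) - of_bool (p \<le> y - 1) :: real) = of_bool (y = p)"
        by auto
      then show ?thesis using 1 step by simp
    next
      case 3
      then have "(1 - of_bool (p \<le> d) :: real) = of_bool (y = p)"
        using p by auto
      then show ?thesis using 3 last by simp
    qed (use p in auto)
  qed
  finally show ?thesis .
qed

lemma path_value_letters:
  assumes k: "k \<in> paths d n" and y: "\<And>i. i \<in> {1..n} \<Longrightarrow> y i \<in> {1..d + 1}"
  shows "path_value d n k (\<lambda>l r. of_bool (y (Suc l) = r) - of_bool (y (Suc l) = Suc r))
    = real (card {i \<in> {1..n}. y i = letter_at d k (i - 1)}) - real n / real (d + 1)"
proof -
  have mono: "mono_on {1..d} k" using k by (simp add: paths_def)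
  have "path_value d n k (\<lambda>l r. of_bool (y (Suc l) = r) - of_bool (y (Suc l) = Suc r))
      = (\<Sum>l<n. of_bool (y (Suc l) = letter_at d k l) - 1 / real (d + 1))"
    unfolding path_value_def
  proof (rule sum.cong[OF refl])
    fix l assume l: "l \<in> {..<n}"
    have "(\<Sum>r=1..d. path_coeff d k l r * (of_bool (y (Suc l) = r) - of_bool (y (Suc l) = Suc r)))
      = (\<Sum>r=1..d. (of_bool (letter_at d k l \<le> r) - real r / real (d + 1)) *
          (of_bool (y (Suc l) = r) - of_bool (y (Suc l) = Suc r)))"
      using letter_at_le_iff[OF mono] by (intro sum.cong) (auto simp: path_coeff_def)
    also have "\<dots> = of_bool (y (Suc l) = letter_at d k l) - 1 / real (d + 1)"
      using l letter_at_le[of d k l] by (intro letter_indicator_eq y) (auto simp: letter_at_def)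
    finally show "(\<Sum>r=1..d. path_coeff d k l r * (of_bool (y (Suc l) = r) - of_bool (y (Suc l) = Suc r)))
      = of_bool (y (Suc l) = letter_at d k l) - 1 / real (d + 1)" .
  qed
  also have "\<dots> = (\<Sum>l<n. of_bool (y (Suc l) = letter_at d k l)) - real n / real (d + 1)"
    by (simp add: sum_subtractf)
  also have "(\<Sum>l<n. of_bool (y (Suc l) = letter_at d k l))
      = (\<Sum>i\<in>{1..n}. of_bool (y i = letter_at d k (i - 1)) :: real)"
    by (rule sum.reindex_bij_witness[of _ "\<lambda>i. i - 1" Suc]) auto
  also have "\<dots> = real (card {i \<in> {1..n}. y i = letter_at d k (i - 1)})"
    by (simp add: Int_def)
  finally show ?thesis .
qed

lemma LI_candidate_iff:
  fixes x :: "nat \<Rightarrow> 'c::linorder"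
  shows "(\<exists>s :: nat \<Rightarrow> nat. strict_mono_on {1..l} s \<and> s ` {1..l} \<subseteq> {1..n} \<and> mono_on {1..l} (x \<circ> s))
    \<longleftrightarrow> (\<exists>I \<subseteq> {1..n}. card I = l \<and> mono_on I x)"
proof
  assume "\<exists>s :: nat \<Rightarrow> nat. strict_mono_on {1..l} s \<and> s ` {1..l} \<subseteq> {1..n} \<and> mono_on {1..l} (x \<circ> s)"
  then obtain s :: "nat \<Rightarrow> nat" where s: "strict_mono_on {1..l} s" "s ` {1..l} \<subseteq> {1..n}" "mono_on {1..l} (x \<circ> s)"
    by (elim exE conjE)
  have "card (s ` {1..l}) = l"
    using card_image[OF strict_mono_on_imp_inj_on[OF s(1)]] by simp
  moreover have "mono_on (s ` {1..l}) x"
  proof (rule mono_onI)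
    fix a b assume ab: "a \<in> s ` {1..l}" "b \<in> s ` {1..l}" "a \<le> b"
    then obtain i j where ij: "i \<in> {1..l}" "j \<in> {1..l}" "a = s i" "b = s j" by blast
    have "i \<le> j"
      using s(1) ij ab(3) by (meson linorder_not_le strict_mono_onD)
    then show "x a \<le> x b"
      using s(3) ij by (auto simp: monotone_on_def)
  qed
  ultimately show "\<exists>I \<subseteq> {1..n}. card I = l \<and> mono_on I x"
    using s(2) by blast
next
  assume "\<exists>I \<subseteq> {1..n}. card I = l \<and> mono_on I x"
  then obtain I where I: "I \<subseteq> {1..n}" "card I = l" "mono_on I x" by blast
  have fin: "finite I" using I(1) by (rule finite_subset) simp
  define L where "L = sorted_list_of_set I"
  have L: "length L = l" "set L = I" "sorted_wrt (<) L"
    using fin I(2) by (auto simp: L_def)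
  define s where "s i = L ! (i - 1)" for i
  have sm: "strict_mono_on {1..l} s"
    unfolding s_def
    using L(1) by (intro strict_mono_onI sorted_wrt_nth_less[OF L(3)]) auto
  moreover have img: "s ` {1..l} \<subseteq> I"
    using L unfolding s_def by auto
  moreover have "mono_on {1..l} (x \<circ> s)"
  proof (rule mono_onI)
    fix a b :: nat assume ab: "a \<in> {1..l}" "b \<in> {1..l}" "a \<le> b"
    then have "s a \<le> s b"
      using sm by (metis order_le_less strict_mono_onD)
    then show "(x \<circ> s) a \<le> (x \<circ> s) b"
      using mono_onD[OF I(3), of "s a" "s b"] img ab by (simp add: image_subset_iff)
  qed
  ultimately show "\<exists>s :: nat \<Rightarrow> nat. strict_mono_on {1..l} s \<and> s ` {1..l} \<subseteq> {1..n} \<and> mono_on {1..l} (x \<circ> s)"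
    using I(1) by (intro exI[of _ s] conjI) (auto dest: subset_trans)
qed

lemma LI_ge:
  assumes "I \<subseteq> {1..n}" "mono_on I x"
  shows "card I \<le> LI x n"
proof -
  have "card I \<in> {l. \<exists>s :: nat \<Rightarrow> nat. strict_mono_on {1..l} s \<and> s ` {1..l} \<subseteq> {1..n} \<and> mono_on {1..l} (x \<circ> s)}"
    unfolding mem_Collect_eq LI_candidate_iff using assms by blast
  then show ?thesis
    unfolding LI_def by (rule Max_ge[OF LI_candidates(1)])
qed

lemma LI_attained: "\<exists>I \<subseteq> {1..n}. card I = LI x n \<and> mono_on I x"
proof -
  have "LI x n \<in> {l. \<exists>s :: nat \<Rightarrow> nat. strict_mono_on {1..l} s \<and> s ` {1..l} \<subseteq> {1..n} \<and> mono_on {1..l} (x \<circ> s)}"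
    unfolding LI_def by (rule Max_in[OF LI_candidates])
  then show ?thesis
    unfolding mem_Collect_eq LI_candidate_iff .
qed

text \<open>The positions at which the word shows the letter read by a path form an increasing subsequence.
  Conversely, given an increasing subsequence, change from letter \<open>r\<close> to letter \<open>r + 1\<close> right after the
  last chosen position whose letter is at most \<open>r\<close>; this path reads the correct letter at every
  chosen position.\<close>

lemma LI_eq_max_value:
  fixes x :: "nat \<Rightarrow> 'c::linorder" and y :: "nat \<Rightarrow> nat"
  assumes y: "\<And>i. i \<in> {1..n} \<Longrightarrow> y i \<in> {1..d + 1}"
    and ord: "\<And>i j. i \<in> {1..n} \<Longrightarrow> j \<in> {1..n} \<Longrightarrow> x i \<le> x j \<longleftrightarrow> y i \<le> y j"
  shows "real (LI x n) - real n / real (d + 1)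
    = max_value d n (\<lambda>l r. of_bool (y (Suc l) = r) - of_bool (y (Suc l) = Suc r))"
  unfolding max_value_def
proof (rule sym, rule Max_eqI)
  fix v assume "v \<in> (\<lambda>k. path_value d n k (\<lambda>l r. of_bool (y (Suc l) = r) - of_bool (y (Suc l) = Suc r))) ` paths d n"
  then obtain k where k: "k \<in> paths d n"
    and v: "v = real (card {i \<in> {1..n}. y i = letter_at d k (i - 1)}) - real n / real (d + 1)"
    using path_value_letters[of _ d n y] y by auto
  let ?I = "{i \<in> {1..n}. y i = letter_at d k (i - 1)}"
  have "mono_on ?I x"
    by (rule mono_onI) (auto simp: ord intro!: letter_at_mono)
  then have "card ?I \<le> LI x n"
    by (intro LI_ge) auto
  then show "v \<le> real (LI x n) - real n / real (d + 1)"
    by (simp add: v)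
next
  obtain I where I: "I \<subseteq> {1..n}" "card I = LI x n" "mono_on I x"
    using LI_attained by blast
  have fin: "finite I" using I(1) by (rule finite_subset) simp
  \<comment> \<open>The value is \<open>0\<close> when no chosen position carries a letter up to \<open>r\<close>.\<close>
  define k where "k = (\<lambda>r\<in>{1..d}. Max (insert 0 {i \<in> I. y i \<le> r}))"
  have "k \<in> paths d n"
    unfolding paths_def
  proof (intro CollectI conjI mono_onI PiE_I)
    show "k r \<in> {0..n}" if "r \<in> {1..d}" for r
      using that I(1) fin by (auto simp: k_def)
    show "k r \<le> k s" if "r \<in> {1..d}" "s \<in> {1..d}" "r \<le> s" for r s
      using that fin by (auto simp: k_def intro!: Max_mono)
  qed (auto simp: k_def)
  moreover have "I \<subseteq> {i \<in> {1..n}. y i = letter_at d k (i - 1)}"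
  proof
    fix i assume i: "i \<in> I"
    then have i1: "i \<in> {1..n}" using I(1) by blast
    have "k r \<le> i - 1 \<longleftrightarrow> r < y i" if r: "r \<in> {1..d}" for r
    proof (cases "y i \<le> r")
      case True
      then have "i \<le> k r"
        using r i fin by (auto simp: k_def)
      then show ?thesis using True i1 by auto
    next
      case False
      have "j < i" if j: "j \<in> I" "y j \<le> r" for j
      proof (rule ccontr)
        assume "\<not> j < i"
        then have "x i \<le> x j"
          using mono_onD[OF I(3) i j(1)] by simp
        then have "y i \<le> y j"
          using ord[OF i1, of j] j(1) I(1) by blast
        then show False using False j(2) by simp
      qed
      then have "k r < i"
        using r fin i1 by (auto simp: k_def)
      then show ?thesis using False by auto
    qed
    then have "{r \<in> {1..d}. k r \<le> i - 1} = {1..<y i}"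
      using y[OF i1] by auto
    then show "i \<in> {i \<in> {1..n}. y i = letter_at d k (i - 1)}"
      using i1 y[OF i1] by (auto simp: letter_at_def)
  qed
  then have "LI x n \<le> card {i \<in> {1..n}. y i = letter_at d k (i - 1)}"
    unfolding I(2)[symmetric] by (intro card_mono) auto
  moreover have "card {i \<in> {1..n}. y i = letter_at d k (i - 1)} \<le> LI x n"
    by (intro LI_ge) (auto intro!: mono_onI letter_at_mono simp: ord)
  ultimately show "real (LI x n) - real n / real (d + 1)
      \<in> (\<lambda>k. path_value d n k (\<lambda>l r. of_bool (y (Suc l) = r) - of_bool (y (Suc l) = Suc r))) ` paths d n"
    using path_value_letters[of k d n y, OF \<open>k \<in> paths d n\<close>] y \<open>k \<in> paths d n\<close>
    by (intro image_eqI[of _ _ k]) simp_all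
qed simp

section \<open>Smoothness of the logarithm of a sum of exponentials\<close>

text \<open>The moments of \<open>c\<close> under the Gibbs weights \<open>w k exp (s c k)\<close>; the sum with \<open>j = 0\<close> is the partition
  function, and its logarithm generates the cumulants.\<close>

definition tilted_sum :: "'k set \<Rightarrow> ('k \<Rightarrow> real) \<Rightarrow> ('k \<Rightarrow> real) \<Rightarrow> nat \<Rightarrow> real \<Rightarrow> real" where
  "tilted_sum T w c j s = (\<Sum>k\<in>T. w k * c k ^ j * exp (s * c k))"

definition tilted_moment :: "'k set \<Rightarrow> ('k \<Rightarrow> real) \<Rightarrow> ('k \<Rightarrow> real) \<Rightarrow> nat \<Rightarrow> real \<Rightarrow> real" where
  "tilted_moment T w c j s = tilted_sum T w c j s / tilted_sum T w c 0 s"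

context
  fixes T :: "'k set" and w c :: "'k \<Rightarrow> real"
  assumes fin: "finite T" and ne: "T \<noteq> {}" and w_pos: "\<And>k. k \<in> T \<Longrightarrow> 0 < w k"
begin

lemma tilted_sum_0_pos: "0 < tilted_sum T w c 0 s"
  unfolding tilted_sum_def using fin ne w_pos by (intro sum_pos) auto

lemma tilted_sum_deriv: "(tilted_sum T w c j has_real_derivative tilted_sum T w c (Suc j) s) (at s)"
  unfolding tilted_sum_def by (auto intro!: derivative_eq_intros sum.cong simp: algebra_simps)

lemma tilted_moment_deriv:
  "(tilted_moment T w c j has_real_derivative tilted_moment T w c (Suc j) s - tilted_moment T w c j s * tilted_moment T w c 1 s) (at s)"
  unfolding tilted_moment_def[abs_def]
  using tilted_sum_0_pos[of s]
  by (auto intro!: derivative_eq_intros tilted_sum_deriv simp: field_simps)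

lemma ln_tilted_sum_deriv: "((\<lambda>s. ln (tilted_sum T w c 0 s)) has_real_derivative tilted_moment T w c 1 s) (at s)"
  using tilted_sum_0_pos[of s]
  by (auto intro!: derivative_eq_intros tilted_sum_deriv simp: tilted_moment_def)

lemma tilted_moment_bound:
  assumes "\<And>k. k \<in> T \<Longrightarrow> \<bar>c k\<bar> \<le> C"
  shows "\<bar>tilted_moment T w c j s\<bar> \<le> C ^ j"
proof -
  have "\<bar>tilted_sum T w c j s\<bar> \<le> (\<Sum>k\<in>T. \<bar>w k * c k ^ j * exp (s * c k)\<bar>)"
    unfolding tilted_sum_def by (rule sum_abs)
  also have "\<dots> \<le> (\<Sum>k\<in>T. C ^ j * (w k * exp (s * c k)))"
  proof (rule sum_mono)
    fix k assume k: "k \<in> T"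
    have "\<bar>w k * c k ^ j * exp (s * c k)\<bar> = \<bar>c k\<bar> ^ j * (w k * exp (s * c k))"
      using w_pos[OF k] by (simp add: abs_mult power_abs)
    also have "\<dots> \<le> C ^ j * (w k * exp (s * c k))"
      using assms[OF k] w_pos[OF k] by (intro mult_right_mono power_mono) auto
    finally show "\<bar>w k * c k ^ j * exp (s * c k)\<bar> \<le> C ^ j * (w k * exp (s * c k))" .
  qed
  also have "\<dots> = C ^ j * tilted_sum T w c 0 s"
    by (simp add: tilted_sum_def sum_distrib_left)
  finally show ?thesis
    using tilted_sum_0_pos[of s] by (simp add: tilted_moment_def field_simps)
qed

text \<open>The derivatives of the logarithm of the partition function are cumulants of \<open>c\<close> under a probability
  measure. They are bounded by multiples of powers of \<open>C\<close>, whatever the number of terms of the sum is, and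
  this is what makes the third-order remainder independent of the number of paths below.\<close>

lemma cos_ln_tilted_sum_taylor:
  fixes v \<theta> C :: real
  assumes c: "\<And>k. k \<in> T \<Longrightarrow> \<bar>c k\<bar> \<le> C"
  defines "\<psi> \<equiv> v * ln (tilted_sum T w c 0 0) + \<theta>"
    and "m\<^sub>1 \<equiv> tilted_moment T w c 1 0" and "m\<^sub>2 \<equiv> tilted_moment T w c 2 0"
  shows "\<bar>cos (v * ln (tilted_sum T w c 0 1) + \<theta>)
    - (cos \<psi> - v * m\<^sub>1 * sin \<psi> - (v * (m\<^sub>2 - m\<^sub>1\<^sup>2) * sin \<psi> + v\<^sup>2 * m\<^sub>1\<^sup>2 * cos \<psi>) / 2)\<bar>
    \<le> (\<bar>v\<bar> + v\<^sup>2 + \<bar>v\<bar> ^ 3) * C ^ 3"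
proof -
  define m where "m = tilted_moment T w c"
  define P where "P s = v * ln (tilted_sum T w c 0 s) + \<theta>" for s
  define V where "V s = m 2 s - (m 1 s)\<^sup>2" for s
  \<comment> \<open>\<open>V\<close> and \<open>W\<close> are the second and third cumulants, and \<open>f1\<close>, \<open>f2\<close>, \<open>f3\<close> the derivatives of \<open>cos (P s)\<close>.\<close>
  define W where "W s = m 3 s - 3 * m 1 s * m 2 s + 2 * m 1 s ^ 3" for s
  define f1 where "f1 s = - (v * m 1 s * sin (P s))" for s
  define f2 where "f2 s = - (v * V s * sin (P s) + v\<^sup>2 * (m 1 s)\<^sup>2 * cos (P s))" for s
  define f3 where "f3 s = - v * W s * sin (P s) - 3 * v\<^sup>2 * (m 1 s * V s) * cos (P s) + v ^ 3 * m 1 s ^ 3 * sin (P s)" for s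
  have dP: "(P has_real_derivative v * m 1 s) (at s)" for s
    unfolding P_def[abs_def] m_def
    using DERIV_add[OF DERIV_cmult[OF ln_tilted_sum_deriv] DERIV_const] by simp
  have dm1: "(m 1 has_real_derivative V s) (at s)" for s
    using tilted_moment_deriv[of 1 s] by (simp add: m_def V_def power2_eq_square numeral_2_eq_2)
  have dm2: "(m 2 has_real_derivative m 3 s - m 2 s * m 1 s) (at s)" for s
    using tilted_moment_deriv[of 2 s] by (simp add: m_def numeral_3_eq_3 numeral_2_eq_2)
  have dV: "(V has_real_derivative W s) (at s)" for s
    unfolding V_def[abs_def] W_def
    by (rule derivative_eq_intros dm1 dm2 refl)+ (simp add: V_def algebra_simps power2_eq_square power3_eq_cube)
  have d0: "((\<lambda>s. cos (P s)) has_real_derivative f1 s) (at s)" for s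
    unfolding f1_def by (rule derivative_eq_intros dP refl)+ simp
  have d1: "(f1 has_real_derivative f2 s) (at s)" for s
    unfolding f1_def[abs_def] f2_def
    by (rule derivative_eq_intros dP dm1 refl)+ (simp add: algebra_simps power2_eq_square)
  have d2: "(f2 has_real_derivative f3 s) (at s)" for s
    unfolding f2_def[abs_def] f3_def
    by (rule derivative_eq_intros dP dm1 dV refl)+
       (simp add: algebra_simps power2_eq_square power3_eq_cube)
  define diff where "diff j = (if j = 0 then (\<lambda>s. cos (P s)) else if j = 1 then f1 else if j = 2 then f2 else f3)" for j :: nat
  have "\<exists>t. 0 < t \<and> t < 1 \<and> cos (P 1) = (\<Sum>j<3. (diff j 0 / fact j) * 1 ^ j) + (diff 3 t / fact 3) * 1 ^ 3"
  proof (rule Maclaurin)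
    show "\<forall>j t. j < 3 \<and> 0 \<le> t \<and> t \<le> 1 \<longrightarrow> (diff j has_real_derivative diff (Suc j) t) (at t)"
      using d0 d1 d2 by (auto simp: diff_def less_Suc_eq numeral_3_eq_3 numeral_2_eq_2)
  qed (simp_all add: diff_def)
  then obtain t where t: "cos (P 1) = (\<Sum>j<3. (diff j 0 / fact j) * 1 ^ j) + (diff 3 t / fact 3) * 1 ^ 3"
    by blast
  have "(\<Sum>j<3. (diff j 0 / fact j) * 1 ^ j) = cos (P 0) + f1 0 + f2 0 / 2"
    by (simp add: diff_def numeral_3_eq_3 numeral_2_eq_2)
  moreover have "diff 3 t / fact 3 * 1 ^ 3 = f3 t / 6"
    by (simp add: diff_def fact_numeral)
  ultimately have eq: "cos (P 1) - (cos (P 0) + f1 0 + f2 0 / 2) = f3 t / 6"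
    using t by linarith
  have C: "0 \<le> C" using ne c by force
  have b: "\<bar>m j t\<bar> \<le> C ^ j" for j
    unfolding m_def by (rule tilted_moment_bound[OF c])
  have b1: "\<bar>m 1 t\<bar> \<le> C" using b[of 1] by simp
  have b12: "\<bar>m 1 t * m 2 t\<bar> \<le> C ^ 3"
    using mult_mono[OF b1 b[of 2]] C by (simp add: abs_mult power2_eq_square power3_eq_cube)
  have b111: "\<bar>m 1 t ^ 3\<bar> \<le> C ^ 3"
    using power_mono[OF b1, of 3] by (simp add: power_abs)
  have bW: "\<bar>W t\<bar> \<le> 6 * C ^ 3"
    using b[of 3] b12 b111 unfolding W_def by (simp add: abs_le_iff)
  have bV: "\<bar>m 1 t * V t\<bar> \<le> 2 * C ^ 3"
  proof -
    have "m 1 t * V t = m 1 t * m 2 t - m 1 t ^ 3"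
      by (simp add: V_def algebra_simps power2_eq_square power3_eq_cube)
    then show ?thesis using b12 b111 by linarith
  qed
  have "\<bar>v * W t * sin (P t)\<bar> \<le> (\<bar>v\<bar> * (6 * C ^ 3)) * 1"
    unfolding abs_mult by (intro mult_mono bW) (auto simp: C)
  moreover have "\<bar>3 * v\<^sup>2 * (m 1 t * V t) * cos (P t)\<bar> \<le> (3 * v\<^sup>2 * (2 * C ^ 3)) * 1"
    unfolding abs_mult[of _ "cos _"] abs_mult[of "3 * v\<^sup>2"] by (intro mult_mono bV) (auto simp: C abs_mult)
  moreover have "\<bar>v ^ 3 * m 1 t ^ 3 * sin (P t)\<bar> \<le> (\<bar>v\<bar> ^ 3 * C ^ 3) * 1"
    unfolding abs_mult[of _ "sin _"] abs_mult[of "v ^ 3"] by (intro mult_mono b111) (auto simp: C power_abs)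
  moreover have "0 \<le> \<bar>v\<bar> ^ 3 * C ^ 3" using C by simp
  ultimately have "\<bar>f3 t\<bar> \<le> 6 * (\<bar>v\<bar> * C ^ 3) + 6 * (v\<^sup>2 * C ^ 3) + 6 * (\<bar>v\<bar> ^ 3 * C ^ 3)"
    unfolding f3_def by linarith
  then have "\<bar>f3 t\<bar> \<le> 6 * ((\<bar>v\<bar> + v\<^sup>2 + \<bar>v\<bar> ^ 3) * C ^ 3)"
    by (simp add: distrib_left distrib_right)
  then have remainder: "\<bar>f3 t / 6\<bar> \<le> (\<bar>v\<bar> + v\<^sup>2 + \<bar>v\<bar> ^ 3) * C ^ 3" by simp
  have expand: "cos (P 0) + f1 0 + f2 0 / 2
    = cos \<psi> - v * m\<^sub>1 * sin \<psi> - (v * (m\<^sub>2 - m\<^sub>1\<^sup>2) * sin \<psi> + v\<^sup>2 * m\<^sub>1\<^sup>2 * cos \<psi>) / 2"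
    by (simp add: P_def f1_def f2_def V_def m_def \<psi>_def m\<^sub>1_def m\<^sub>2_def field_simps)
  show ?thesis
    using remainder unfolding eq[symmetric] expand unfolding P_def .
qed

end

text \<open>Apply the previous expansion along the segment from \<open>0\<close> to \<open>z\<close>: with \<open>c k = \<beta> \<langle>a k, z\<rangle>\<close> the first
  moment is linear in \<open>z\<close> and the second one quadratic. The condition \<open>\<beta> \<ge> 1\<close> serves to bound lower powers
  of \<open>\<beta>\<close> by \<open>\<beta>\<^sup>2\<close>.\<close>

lemma cos_log_sum_exp_taylor:
  fixes T :: "'k set" and w :: "'k \<Rightarrow> real" and a :: "'k \<Rightarrow> nat \<Rightarrow> real" and \<beta> u \<theta> :: real
  assumes fin: "finite T" and ne: "T \<noteq> {}" and w_pos: "\<And>k. k \<in> T \<Longrightarrow> 0 < w k"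
    and a: "\<And>k r. k \<in> T \<Longrightarrow> r \<in> {1..d} \<Longrightarrow> \<bar>a k r\<bar> \<le> 1" and \<beta>: "\<beta> \<ge> 1"
  shows "\<exists>p\<^sub>0 p q. \<forall>z.
    \<bar>cos (u / \<beta> * ln (\<Sum>k\<in>T. w k * exp (\<beta> * (\<Sum>r=1..d. a k r * z r))) + \<theta>)
      - (p\<^sub>0 + (\<Sum>r=1..d. p r * z r) + (\<Sum>r=1..d. \<Sum>s=1..d. q r s * (z r * z s)))\<bar>
    \<le> (\<bar>u\<bar> + u\<^sup>2 + \<bar>u\<bar> ^ 3) * \<beta>\<^sup>2 * (\<Sum>r=1..d. \<bar>z r\<bar>) ^ 3"
proof -
  define W where "W = (\<Sum>k\<in>T. w k)"
  define v where "v = u / \<beta>"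
  define \<psi> where "\<psi> = v * ln W + \<theta>"
  define A where "A r = \<beta> * (\<Sum>k\<in>T. w k * a k r) / W" for r
  define D where "D r s = \<beta>\<^sup>2 * (\<Sum>k\<in>T. w k * (a k r * a k s)) / W" for r s
  define q where "q r s = - (v * (D r s - A r * A s) * sin \<psi> + v\<^sup>2 * (A r * A s) * cos \<psi>) / 2" for r s
  show ?thesis
  proof (intro exI[of _ "cos \<psi>"] exI[of _ "\<lambda>r. - v * A r * sin \<psi>"] exI[of _ q] allI)
    fix z :: "nat \<Rightarrow> real"
    define c where "c k = \<beta> * (\<Sum>r=1..d. a k r * z r)" for k
    define S where "S = (\<Sum>r=1..d. \<bar>z r\<bar>)"
    have cb: "\<bar>c k\<bar> \<le> \<beta> * S" if k: "k \<in> T" for k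
    proof -
      have "\<bar>\<Sum>r=1..d. a k r * z r\<bar> \<le> (\<Sum>r=1..d. \<bar>a k r * z r\<bar>)" by (rule sum_abs)
      also have "\<dots> \<le> S"
        unfolding S_def
      proof (rule sum_mono)
        fix r assume r: "r \<in> {1..d}"
        show "\<bar>a k r * z r\<bar> \<le> \<bar>z r\<bar>"
          using mult_right_mono[OF a[OF k r], of "\<bar>z r\<bar>"] by (simp add: abs_mult)
      qed
      finally show ?thesis using \<beta> by (simp add: c_def abs_mult)
    qed
    have t0: "tilted_sum T w c 0 0 = W"
      using tilted_sum_def[of T w c] by (simp add: W_def)
    have t1: "tilted_sum T w c 0 1 = (\<Sum>k\<in>T. w k * exp (c k))"
      using tilted_sum_def[of T w c] by simp
    have m1: "tilted_moment T w c 1 0 = (\<Sum>r=1..d. A r * z r)"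
    proof -
      have "tilted_sum T w c 1 0 = (\<Sum>k\<in>T. \<Sum>r=1..d. \<beta> * (w k * a k r) * z r)"
        using tilted_sum_def[of T w c]
        by (simp add: c_def sum_distrib_left algebra_simps)
      also have "\<dots> = (\<Sum>r=1..d. \<Sum>k\<in>T. \<beta> * (w k * a k r) * z r)"
        by (rule sum.swap)
      finally show ?thesis
        using tilted_moment_def[of T w c] t0
        by (simp add: A_def sum_distrib_left sum_distrib_right sum_divide_distrib mult_ac)
    qed
    have m2: "tilted_moment T w c 2 0 = (\<Sum>r=1..d. \<Sum>s=1..d. D r s * (z r * z s))"
    proof -
      have "tilted_sum T w c 2 0 = (\<Sum>k\<in>T. \<Sum>r=1..d. \<Sum>s=1..d. \<beta>\<^sup>2 * (w k * (a k r * a k s)) * (z r * z s))"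
        using tilted_sum_def[of T w c]
        by (simp add: c_def power_mult_distrib power2_eq_square sum_product sum_distrib_left mult_ac)
      also have "\<dots> = (\<Sum>r=1..d. \<Sum>k\<in>T. \<Sum>s=1..d. \<beta>\<^sup>2 * (w k * (a k r * a k s)) * (z r * z s))"
        by (rule sum.swap)
      also have "\<dots> = (\<Sum>r=1..d. \<Sum>s=1..d. \<Sum>k\<in>T. \<beta>\<^sup>2 * (w k * (a k r * a k s)) * (z r * z s))"
        by (intro sum.cong refl sum.swap)
      finally show ?thesis
        using tilted_moment_def[of T w c] t0
        by (simp add: D_def sum_distrib_left sum_distrib_right sum_divide_distrib mult_ac)
    qed
    have m11: "(tilted_moment T w c 1 0)\<^sup>2 = (\<Sum>r=1..d. \<Sum>s=1..d. A r * A s * (z r * z s))"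
      unfolding m1 by (simp add: power2_eq_square sum_product mult_ac)
    have expansion: "cos \<psi> - v * tilted_moment T w c 1 0 * sin \<psi>
        - (v * (tilted_moment T w c 2 0 - (tilted_moment T w c 1 0)\<^sup>2) * sin \<psi>
           + v\<^sup>2 * (tilted_moment T w c 1 0)\<^sup>2 * cos \<psi>) / 2
      = cos \<psi> + (\<Sum>r=1..d. - v * A r * sin \<psi> * z r) + (\<Sum>r=1..d. \<Sum>s=1..d. q r s * (z r * z s))"
    proof -
      have lin: "(\<Sum>r=1..d. - v * A r * sin \<psi> * z r) = - (v * (\<Sum>r=1..d. A r * z r) * sin \<psi>)"
        by (simp add: sum_distrib_left sum_distrib_right sum_negf mult_ac)
      have quad: "(\<Sum>r=1..d. \<Sum>s=1..d. q r s * (z r * z s))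
        = - (v * ((\<Sum>r=1..d. \<Sum>s=1..d. D r s * (z r * z s)) - (\<Sum>r=1..d. \<Sum>s=1..d. A r * A s * (z r * z s))) * sin \<psi>
             + v\<^sup>2 * (\<Sum>r=1..d. \<Sum>s=1..d. A r * A s * (z r * z s)) * cos \<psi>) / 2"
        by (simp add: q_def sum_subtractf[symmetric] sum.distrib[symmetric] sum_distrib_left
            sum_distrib_right sum_divide_distrib sum_negf[symmetric] algebra_simps)
      show ?thesis unfolding m11 unfolding m1 m2 lin quad by (simp add: field_simps)
    qed
    have "\<bar>cos (v * ln (\<Sum>k\<in>T. w k * exp (c k)) + \<theta>)
        - (cos \<psi> + (\<Sum>r=1..d. - v * A r * sin \<psi> * z r) + (\<Sum>r=1..d. \<Sum>s=1..d. q r s * (z r * z s)))\<bar>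
      \<le> (\<bar>v\<bar> + v\<^sup>2 + \<bar>v\<bar> ^ 3) * (\<beta> * S) ^ 3"
      using cos_ln_tilted_sum_taylor[where T = T and w = w and c = c and v = v and \<theta> = \<theta>, OF fin ne w_pos cb]
      unfolding t0 t1 \<psi>_def[symmetric] expansion by simp
    also have "\<dots> \<le> (\<bar>u\<bar> + u\<^sup>2 + \<bar>u\<bar> ^ 3) * \<beta>\<^sup>2 * S ^ 3"
    proof -
      have "(\<bar>v\<bar> + v\<^sup>2 + \<bar>v\<bar> ^ 3) * \<beta> ^ 3 = \<bar>u\<bar> * \<beta>\<^sup>2 + u\<^sup>2 * \<beta> + \<bar>u\<bar> ^ 3"
        using \<beta> by (simp add: v_def field_simps power2_eq_square power3_eq_cube)
      also have "\<dots> \<le> \<bar>u\<bar> * \<beta>\<^sup>2 + u\<^sup>2 * \<beta>\<^sup>2 + \<bar>u\<bar> ^ 3 * \<beta>\<^sup>2"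
      proof -
        have "\<beta> \<le> \<beta>\<^sup>2" "1 \<le> \<beta>\<^sup>2"
          using \<beta> by (simp_all add: power2_eq_square one_le_power[of \<beta> 2, unfolded power2_eq_square])
        then have "u\<^sup>2 * \<beta> \<le> u\<^sup>2 * \<beta>\<^sup>2" "\<bar>u\<bar> ^ 3 * 1 \<le> \<bar>u\<bar> ^ 3 * \<beta>\<^sup>2"
          by (intro mult_left_mono; simp)+
        then show ?thesis by simp
      qed
      finally have "(\<bar>v\<bar> + v\<^sup>2 + \<bar>v\<bar> ^ 3) * \<beta> ^ 3 * S ^ 3 \<le> (\<bar>u\<bar> + u\<^sup>2 + \<bar>u\<bar> ^ 3) * \<beta>\<^sup>2 * S ^ 3"
        by (intro mult_right_mono) (auto simp: algebra_simps S_def sum_nonneg)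
      then show ?thesis by (simp add: power_mult_distrib mult_ac)
    qed
    finally show "\<bar>cos (u / \<beta> * ln (\<Sum>k\<in>T. w k * exp (\<beta> * (\<Sum>r=1..d. a k r * z r))) + \<theta>)
      - (cos \<psi> + (\<Sum>r=1..d. - v * A r * sin \<psi> * z r) + (\<Sum>r=1..d. \<Sum>s=1..d. q r s * (z r * z s)))\<bar>
    \<le> (\<bar>u\<bar> + u\<^sup>2 + \<bar>u\<bar> ^ 3) * \<beta>\<^sup>2 * (\<Sum>r=1..d. \<bar>z r\<bar>) ^ 3"
      by (simp add: c_def S_def v_def)
  qed
qed

section \<open>Lindeberg replacement for the maximum over paths\<close>

text \<open>The laws of the coordinates are exchanged one after the other. By Fubini, exchanging the law of
  one coordinate is done with all the others held fixed, and this costs at most \<open>\<epsilon>\<close>.\<close>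

lemma lindeberg_replacement:
  fixes \<mu> \<nu> :: "'s measure" and h :: "('i \<Rightarrow> 's) \<Rightarrow> real"
  assumes \<mu>: "prob_space \<mu>" and \<nu>: "prob_space \<nu>" and sets: "sets \<nu> = sets \<mu>"
    and "finite I"
    and "h \<in> borel_measurable (PiM I (\<lambda>_. \<mu>))" and "\<And>x. \<bar>h x\<bar> \<le> b"
    and "\<And>i x. i \<in> I \<Longrightarrow> \<bar>(\<integral>z. h (x(i := z)) \<partial>\<mu>) - (\<integral>z. h (x(i := z)) \<partial>\<nu>)\<bar> \<le> \<epsilon>"
  shows "\<bar>integral\<^sup>L (PiM I (\<lambda>_. \<mu>)) h - integral\<^sup>L (PiM I (\<lambda>_. \<nu>)) h\<bar> \<le> real (card I) * \<epsilon>"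
  using assms(4-)
proof (induction I arbitrary: h rule: finite_induct)
  case empty
  show ?case by (simp add: PiM_empty)
next
  case (insert i I)
  interpret \<mu>: prob_space \<mu> by fact
  interpret \<nu>: prob_space \<nu> by fact
  interpret P\<mu>: product_prob_space "\<lambda>_. \<mu>" by unfold_locales
  interpret P\<nu>: product_prob_space "\<lambda>_. \<nu>" by unfold_locales
  interpret I\<mu>: prob_space "PiM I (\<lambda>_. \<mu>)" by (intro prob_space_PiM \<mu>)
  interpret I\<nu>: prob_space "PiM I (\<lambda>_. \<nu>)" by (intro prob_space_PiM \<nu>)
  interpret J\<mu>: prob_space "PiM (insert i I) (\<lambda>_. \<mu>)" by (intro prob_space_PiM \<mu>)
  interpret J\<nu>: prob_space "PiM (insert i I) (\<lambda>_. \<nu>)" by (intro prob_space_PiM \<nu>)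
  have sets_J: "sets (PiM J (\<lambda>_. \<nu>)) = sets (PiM J (\<lambda>_. \<mu>))" for J :: "'i set"
    by (intro sets_PiM_cong) (simp_all add: sets)
  note [measurable_cong] = sets
  note h [measurable] = insert.prems(1)
  have h\<nu>: "h \<in> borel_measurable (PiM (insert i I) (\<lambda>_. \<nu>))"
    using h by (simp cong: measurable_cong_sets add: measurable_cong_sets[OF sets_J refl])
  have upd: "(\<lambda>(x, z). h (x(i := z))) \<in> borel_measurable (PiM I (\<lambda>_. \<mu>) \<Otimes>\<^sub>M \<mu>)"
    using measurable_comp[OF measurable_add_dim h] by (simp add: comp_def case_prod_beta')
  have upd\<nu>: "(\<lambda>(x, z). h (x(i := z))) \<in> borel_measurable (PiM I (\<lambda>_. \<nu>) \<Otimes>\<^sub>M \<mu>)"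
    using upd by (simp add: measurable_cong_sets[OF sets_pair_measure_cong[OF sets_J refl] refl])
  have upd\<nu>\<nu>: "(\<lambda>(x, z). h (x(i := z))) \<in> borel_measurable (PiM I (\<lambda>_. \<nu>) \<Otimes>\<^sub>M \<nu>)"
    using upd by (simp add: measurable_cong_sets[OF sets_pair_measure_cong[OF sets_J sets] refl])
  interpret M: pair_prob_space "PiM I (\<lambda>_. \<mu>)" \<mu> by unfold_locales
  interpret X: pair_prob_space "PiM I (\<lambda>_. \<nu>)" \<mu> by unfold_locales
  interpret Y: pair_prob_space "PiM I (\<lambda>_. \<nu>)" \<nu> by unfold_locales
  have int: "integrable Q f" if "prob_space Q" "f \<in> borel_measurable Q" "\<And>x. \<bar>f x\<bar> \<le> b"
    for Q :: "'q measure" and f :: "'q \<Rightarrow> real"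
  proof -
    interpret Q: prob_space Q by fact
    show ?thesis using that(2,3) by (intro Q.integrable_const_bound[of _ b]) auto
  qed
  have iM: "integrable (PiM I (\<lambda>_. \<mu>) \<Otimes>\<^sub>M \<mu>) (\<lambda>(x, z). h (x(i := z)))"
    by (rule int[OF M.prob_space_axioms upd]) (auto simp: insert.prems(2))
  have iX: "integrable (PiM I (\<lambda>_. \<nu>) \<Otimes>\<^sub>M \<mu>) (\<lambda>(x, z). h (x(i := z)))"
    by (rule int[OF X.prob_space_axioms upd\<nu>]) (auto simp: insert.prems(2))
  have iY: "integrable (PiM I (\<lambda>_. \<nu>) \<Otimes>\<^sub>M \<nu>) (\<lambda>(x, z). h (x(i := z)))"
    by (rule int[OF Y.prob_space_axioms upd\<nu>\<nu>]) (auto simp: insert.prems(2))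
  \<comment> \<open>The intermediate value has law \<nu> at the old coordinates and \<mu> at the new one.\<close>
  define mid where "mid = (\<integral>z. (\<integral>x. h (x(i := z)) \<partial>PiM I (\<lambda>_. \<nu>)) \<partial>\<mu>)"
  have 1: "integral\<^sup>L (PiM (insert i I) (\<lambda>_. \<mu>)) h = (\<integral>z. (\<integral>x. h (x(i := z)) \<partial>PiM I (\<lambda>_. \<mu>)) \<partial>\<mu>)"
    by (rule trans[OF P\<mu>.product_integral_insert[OF insert.hyps int[OF J\<mu>.prob_space_axioms h insert.prems(2)]]
          M.Fubini_integral[OF iM, symmetric]])
  have 2: "integral\<^sup>L (PiM (insert i I) (\<lambda>_. \<nu>)) h = (\<integral>x. (\<integral>z. h (x(i := z)) \<partial>\<nu>) \<partial>PiM I (\<lambda>_. \<nu>))"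
    by (rule P\<nu>.product_integral_insert[OF insert.hyps int[OF J\<nu>.prob_space_axioms h\<nu> insert.prems(2)]])
  have 3: "mid = (\<integral>x. (\<integral>z. h (x(i := z)) \<partial>\<mu>) \<partial>PiM I (\<lambda>_. \<nu>))"
    unfolding mid_def by (rule X.Fubini_integral[OF iX])
  have old: "\<bar>integral\<^sup>L (PiM (insert i I) (\<lambda>_. \<mu>)) h - mid\<bar> \<le> real (card I) * \<epsilon>"
  proof -
    have "integral\<^sup>L (PiM (insert i I) (\<lambda>_. \<mu>)) h - mid
      = (\<integral>z. (\<integral>x. h (x(i := z)) \<partial>PiM I (\<lambda>_. \<mu>)) - (\<integral>x. h (x(i := z)) \<partial>PiM I (\<lambda>_. \<nu>)) \<partial>\<mu>)"
      unfolding 1 mid_def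
      by (rule Bochner_Integration.integral_diff[symmetric] M.integrable_snd[OF iM] X.integrable_snd[OF iX])+
    also have "\<bar>\<dots>\<bar> \<le> (\<integral>z. \<bar>(\<integral>x. h (x(i := z)) \<partial>PiM I (\<lambda>_. \<mu>)) - (\<integral>x. h (x(i := z)) \<partial>PiM I (\<lambda>_. \<nu>))\<bar> \<partial>\<mu>)"
      by (rule integral_abs_bound)
    also have "\<dots> \<le> real (card I) * \<epsilon>"
    proof (rule \<mu>.integral_le_const)
      show "AE z in \<mu>. \<bar>(\<integral>x. h (x(i := z)) \<partial>PiM I (\<lambda>_. \<mu>)) - (\<integral>x. h (x(i := z)) \<partial>PiM I (\<lambda>_. \<nu>))\<bar> \<le> real (card I) * \<epsilon>"
      proof (rule AE_I2)
        fix z assume z: "z \<in> space \<mu>"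
        show "\<bar>(\<integral>x. h (x(i := z)) \<partial>PiM I (\<lambda>_. \<mu>)) - (\<integral>x. h (x(i := z)) \<partial>PiM I (\<lambda>_. \<nu>))\<bar> \<le> real (card I) * \<epsilon>"
        proof (rule insert.IH)
          show "(\<lambda>x. h (x(i := z))) \<in> borel_measurable (PiM I (\<lambda>_. \<mu>))"
            using measurable_compose[OF measurable_Pair2'[OF z] upd] by simp
          fix j x assume j: "j \<in> I"
          then have twist: "x(j := y, i := z) = (x(i := z))(j := y)" for y
            using insert.hyps by (intro fun_upd_twist) auto
          show "\<bar>(\<integral>y. h (x(j := y, i := z)) \<partial>\<mu>) - (\<integral>y. h (x(j := y, i := z)) \<partial>\<nu>)\<bar> \<le> \<epsilon>"
            unfolding twist by (rule insert.prems(3)) (simp add: j)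
        qed (rule insert.prems(2))
      qed
    qed (intro integrable_abs Bochner_Integration.integrable_diff M.integrable_snd[OF iM] X.integrable_snd[OF iX])
    finally show ?thesis .
  qed
  have new: "\<bar>mid - integral\<^sup>L (PiM (insert i I) (\<lambda>_. \<nu>)) h\<bar> \<le> \<epsilon>"
  proof -
    have "mid - integral\<^sup>L (PiM (insert i I) (\<lambda>_. \<nu>)) h
      = (\<integral>x. (\<integral>z. h (x(i := z)) \<partial>\<mu>) - (\<integral>z. h (x(i := z)) \<partial>\<nu>) \<partial>PiM I (\<lambda>_. \<nu>))"
      unfolding 2 3
      by (rule Bochner_Integration.integral_diff[symmetric] X.integrable_fst[OF iX] Y.integrable_fst[OF iY])+
    also have "\<bar>\<dots>\<bar> \<le> (\<integral>x. \<bar>(\<integral>z. h (x(i := z)) \<partial>\<mu>) - (\<integral>z. h (x(i := z)) \<partial>\<nu>)\<bar> \<partial>PiM I (\<lambda>_. \<nu>))"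
      by (rule integral_abs_bound)
    also have "\<dots> \<le> \<epsilon>"
      by (rule I\<nu>.integral_le_const)
        (intro integrable_abs Bochner_Integration.integrable_diff X.integrable_fst[OF iX] Y.integrable_fst[OF iY],
          simp add: insert.prems(3))
    finally show ?thesis .
  qed
  show ?case
    using old new insert.hyps by (simp add: algebra_simps abs_le_iff)
qed

text \<open>The law of a centred random vector with covariance \<open>V\<close> whose coordinates have absolute third
  moments at most \<open>\<kappa>\<close>.\<close>

definition step_law :: "nat \<Rightarrow> (nat \<Rightarrow> nat \<Rightarrow> real) \<Rightarrow> real \<Rightarrow> (nat \<Rightarrow> real) measure \<Rightarrow> bool" where
  "step_law d V \<kappa> \<mu> \<longleftrightarrow> prob_space \<mu> \<and> sets \<mu> = sets (PiM {1..d} (\<lambda>_. borel)) \<and>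
     (\<forall>r\<in>{1..d}. has_bochner_integral \<mu> (\<lambda>z. z r) 0) \<and>
     (\<forall>r\<in>{1..d}. \<forall>s\<in>{1..d}. has_bochner_integral \<mu> (\<lambda>z. z r * z s) (V r s)) \<and>
     (\<forall>r\<in>{1..d}. integrable \<mu> (\<lambda>z. \<bar>z r\<bar> ^ 3) \<and> (\<integral>z. \<bar>z r\<bar> ^ 3 \<partial>\<mu>) \<le> \<kappa>)"

lemma sum_power3_le:
  fixes f :: "nat \<Rightarrow> real"
  assumes "\<And>r. r \<in> {1..d} \<Longrightarrow> 0 \<le> f r"
  shows "(\<Sum>r=1..d. f r) ^ 3 \<le> real d ^ 3 * (\<Sum>r=1..d. f r ^ 3)"
proof (cases "d = 0")
  case False
  define b where "b = Max (f ` {1..d})"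
  have "b \<in> f ` {1..d}" unfolding b_def using False by (intro Max_in) auto
  then obtain r where r: "r \<in> {1..d}" "b = f r" by blast
  have "(\<Sum>r=1..d. f r) \<le> (\<Sum>r=1..d. b)"
    unfolding b_def by (intro sum_mono Max_ge) auto
  then have "(\<Sum>r=1..d. f r) ^ 3 \<le> (real d * b) ^ 3"
    using assms by (intro power_mono sum_nonneg) auto
  also have "\<dots> = real d ^ 3 * f r ^ 3"
    by (simp add: power_mult_distrib r(2))
  also have "f r ^ 3 \<le> (\<Sum>r=1..d. f r ^ 3)"
    using r(1) assms by (intro member_le_sum) auto
  finally show ?thesis by (simp add: mult_left_mono)
qed simp

text \<open>The integral of a quadratic polynomial depends on the covariance only. Two step laws with the same
  covariance therefore give almost the same integral to every function with this expansion.\<close>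

lemma integral_quadratic_approx:
  assumes \<mu>: "step_law d V \<kappa> \<mu>" and G: "G \<in> borel_measurable (PiM {1..d} (\<lambda>_. borel))"
    and G_bound: "\<And>z. \<bar>G z\<bar> \<le> b" and K: "K \<ge> 0"
    and taylor: "\<And>z. \<bar>G z - (p\<^sub>0 + (\<Sum>r=1..d. p r * z r) + (\<Sum>r=1..d. \<Sum>s=1..d. q r s * (z r * z s)))\<bar>
      \<le> K * (\<Sum>r=1..d. \<bar>z r\<bar>) ^ 3"
  shows "\<bar>integral\<^sup>L \<mu> G - (p\<^sub>0 + (\<Sum>r=1..d. \<Sum>s=1..d. q r s * V r s))\<bar> \<le> K * (real d ^ 4 * \<kappa>)"
proof -
  interpret prob_space \<mu> using \<mu> by (simp add: step_law_def)
  have sets: "sets \<mu> = sets (PiM {1..d} (\<lambda>_. borel))"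
    and m1: "\<And>r. r \<in> {1..d} \<Longrightarrow> has_bochner_integral \<mu> (\<lambda>z. z r) 0"
    and m2: "\<And>r s. r \<in> {1..d} \<Longrightarrow> s \<in> {1..d} \<Longrightarrow> has_bochner_integral \<mu> (\<lambda>z. z r * z s) (V r s)"
    and m3: "\<And>r. r \<in> {1..d} \<Longrightarrow> integrable \<mu> (\<lambda>z. \<bar>z r\<bar> ^ 3)"
      "\<And>r. r \<in> {1..d} \<Longrightarrow> (\<integral>z. \<bar>z r\<bar> ^ 3 \<partial>\<mu>) \<le> \<kappa>"
    using \<mu> by (auto simp: step_law_def)
  define Q where "Q z = p\<^sub>0 + (\<Sum>r=1..d. p r * z r) + (\<Sum>r=1..d. \<Sum>s=1..d. q r s * (z r * z s))" for z :: "nat \<Rightarrow> real"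
  have Q: "has_bochner_integral \<mu> Q (p\<^sub>0 + (\<Sum>r=1..d. p r * 0) + (\<Sum>r=1..d. \<Sum>s=1..d. q r s * V r s))"
    unfolding Q_def
    by (intro has_bochner_integral_add has_bochner_integral_sum has_bochner_integral_mult_right m1 m2)
       (auto simp: has_bochner_integral_iff prob_space)
  have G_int: "integrable \<mu> G"
    using G G_bound by (intro integrable_const_bound[of _ b])
      (auto simp: measurable_cong_sets[OF sets refl])
  have "integral\<^sup>L \<mu> G - (p\<^sub>0 + (\<Sum>r=1..d. \<Sum>s=1..d. q r s * V r s)) = (\<integral>z. G z - Q z \<partial>\<mu>)"
    using Q G_int by (simp add: has_bochner_integral_iff)
  also have "\<bar>\<dots>\<bar> \<le> (\<integral>z. \<bar>G z - Q z\<bar> \<partial>\<mu>)"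
    by (rule integral_abs_bound)
  also have "\<dots> \<le> (\<integral>z. K * (real d ^ 3 * (\<Sum>r=1..d. \<bar>z r\<bar> ^ 3)) \<partial>\<mu>)"
  proof (rule integral_mono)
    fix z
    have "K * (\<Sum>r=1..d. \<bar>z r\<bar>) ^ 3 \<le> K * (real d ^ 3 * (\<Sum>r=1..d. \<bar>z r\<bar> ^ 3))"
      by (intro mult_left_mono sum_power3_le K) simp
    then show "\<bar>G z - Q z\<bar> \<le> K * (real d ^ 3 * (\<Sum>r=1..d. \<bar>z r\<bar> ^ 3))"
      using taylor[of z] by (simp add: Q_def)
  qed (use Q G_int m3(1) in \<open>auto simp: has_bochner_integral_iff\<close>)
  also have "\<dots> = K * (real d ^ 3 * (\<Sum>r=1..d. (\<integral>z. \<bar>z r\<bar> ^ 3 \<partial>\<mu>)))"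
    using m3(1) by (simp add: integral_sum)
  also have "\<dots> \<le> K * (real d ^ 3 * (\<Sum>r=1..d. \<kappa>))"
    using m3(2) by (intro mult_left_mono sum_mono K) auto
  also have "\<dots> = K * (real d ^ 4 * \<kappa>)"
    by (simp add: power_Suc2[symmetric] numeral_eq_Suc mult_ac)
  finally show ?thesis .
qed

text \<open>The log-sum-exp smoothing of the maximum over paths, with inverse temperature \<open>\<beta>\<close>.\<close>

definition soft_value :: "nat \<Rightarrow> nat \<Rightarrow> real \<Rightarrow> (nat \<Rightarrow> nat \<Rightarrow> real) \<Rightarrow> real" where
  "soft_value d n \<beta> x = ln (\<Sum>k\<in>paths d n. exp (\<beta> * path_value d n k x)) / \<beta>"

text \<open>The sum of the exponentials lies between its largest term and the number of terms times that
  term. There are at most \<open>(n + 1) ^ d\<close> paths, so that the smoothing costs only a logarithm.\<close>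

lemma soft_value_bounds:
  assumes \<beta>: "\<beta> > 0"
  shows "max_value d n x \<le> soft_value d n \<beta> x"
    and "soft_value d n \<beta> x \<le> max_value d n x + real d * ln (real n + 1) / \<beta>"
proof -
  let ?S = "\<Sum>k\<in>paths d n. exp (\<beta> * path_value d n k x)"
  have "max_value d n x \<in> (\<lambda>k. path_value d n k x) ` paths d n"
    unfolding max_value_def by (intro Max_in) auto
  then obtain k where k: "k \<in> paths d n" "max_value d n x = path_value d n k x" by blast
  have le: "exp (\<beta> * max_value d n x) \<le> ?S"
    unfolding k(2) using k(1) by (intro member_le_sum) auto
  then have "ln (exp (\<beta> * max_value d n x)) \<le> ln ?S"
    using less_le_trans[OF exp_gt_zero le] by (subst ln_le_cancel_iff) auto
  then show "max_value d n x \<le> soft_value d n \<beta> x"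
    using \<beta> by (simp add: soft_value_def field_simps)
  have "?S \<le> (\<Sum>k\<in>paths d n. exp (\<beta> * max_value d n x))"
    using \<beta> by (intro sum_mono) (auto simp: max_value_def intro!: Max_ge)
  also have "\<dots> = real (card (paths d n)) * exp (\<beta> * max_value d n x)"
    by simp
  also have "\<dots> \<le> (real n + 1) ^ d * exp (\<beta> * max_value d n x)"
  proof (rule mult_right_mono)
    have "real (card (paths d n)) \<le> real ((n + 1) ^ d)"
      using card_paths_le by (rule of_nat_mono)
    then show "real (card (paths d n)) \<le> (real n + 1) ^ d" by (simp add: add.commute)
  qed simp
  finally have "ln ?S \<le> ln ((real n + 1) ^ d * exp (\<beta> * max_value d n x))"
    using less_le_trans[OF exp_gt_zero le] by (subst ln_le_cancel_iff) auto
  also have "\<dots> = real d * ln (real n + 1) + \<beta> * max_value d n x"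
    by (simp add: ln_mult ln_realpow)
  finally show "soft_value d n \<beta> x \<le> max_value d n x + real d * ln (real n + 1) / \<beta>"
    using \<beta> by (simp add: soft_value_def field_simps)
qed

lemma abs_path_coeff_le:
  assumes "r \<in> {1..d}"
  shows "\<bar>path_coeff d k l r\<bar> \<le> 1"
  using assms by (auto simp: path_coeff_def of_bool_def field_simps)

lemma path_value_fun_upd:
  assumes "i < n"
  shows "path_value d n k (x(i := z)) = path_value d n k (x(i := \<lambda>_. 0)) + (\<Sum>r=1..d. path_coeff d k i r * z r)"
proof -
  define rest where "rest = (\<Sum>l\<in>{..<n} - {i}. \<Sum>r=1..d. path_coeff d k l r * x l r)"
  have "path_value d n k (x(i := z)) = (\<Sum>r=1..d. path_coeff d k i r * z r) + rest" for z
  proof -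
    have "path_value d n k (x(i := z)) = (\<Sum>r=1..d. path_coeff d k i r * z r)
        + (\<Sum>l\<in>{..<n} - {i}. \<Sum>r=1..d. path_coeff d k l r * (x(i := z)) l r)"
      unfolding path_value_def using assms by (subst sum.remove[of _ i]) auto
    also have "(\<Sum>l\<in>{..<n} - {i}. \<Sum>r=1..d. path_coeff d k l r * (x(i := z)) l r) = rest"
      unfolding rest_def by (intro sum.cong) auto
    finally show ?thesis .
  qed
  from this[of z] this[of "\<lambda>_. 0"] show ?thesis by simp
qed

lemma measurable_path_value [measurable]:
  "path_value d n k \<in> borel_measurable (PiM {..<n} (\<lambda>_. PiM {1..d} (\<lambda>_. borel)))"
  unfolding path_value_def[abs_def]
proof (intro borel_measurable_sum borel_measurable_times borel_measurable_const)
  fix l r assume "l \<in> {..<n}" "r \<in> {1..d}"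
  then show "(\<lambda>x. x l r) \<in> borel_measurable (PiM {..<n} (\<lambda>_. PiM {1..d} (\<lambda>_. borel)))"
    by (rule measurable_compose[OF measurable_component_singleton[of l] measurable_component_singleton[of r]])
qed

lemma measurable_soft_value [measurable]:
  "soft_value d n \<beta> \<in> borel_measurable (PiM {..<n} (\<lambda>_. PiM {1..d} (\<lambda>_. borel)))"
  unfolding soft_value_def[abs_def] by measurable

lemma measurable_max_value [measurable]:
  "max_value d n \<in> borel_measurable (PiM {..<n} (\<lambda>_. PiM {1..d} (\<lambda>_. borel)))"
  unfolding max_value_def[abs_def]
  using finite_paths by (rule borel_measurable_Max) measurable

text \<open>As a function of the single step \<open>z\<close>, the smoothed maximum is the logarithm of a sum
  of exponentials of linear functions of \<open>z\<close>; the other steps enter through the weights.\<close>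

lemma soft_value_swap:
  assumes i: "i < n" and \<beta>: "\<beta> \<ge> 1" and \<mu>: "step_law d V \<kappa> \<mu>" and \<nu>: "step_law d V \<kappa> \<nu>"
  shows "\<bar>(\<integral>z. cos (u * soft_value d n \<beta> (x(i := z)) + \<theta>) \<partial>\<mu>)
      - (\<integral>z. cos (u * soft_value d n \<beta> (x(i := z)) + \<theta>) \<partial>\<nu>)\<bar>
    \<le> 2 * ((\<bar>u\<bar> + u\<^sup>2 + \<bar>u\<bar> ^ 3) * \<beta>\<^sup>2 * (real d ^ 4 * \<kappa>))"
proof -
  let ?K = "(\<bar>u\<bar> + u\<^sup>2 + \<bar>u\<bar> ^ 3) * \<beta>\<^sup>2"
  define w where "w k = exp (\<beta> * path_value d n k (x(i := \<lambda>_. 0)))" for k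
  define G where "G z = cos (u / \<beta> * ln (\<Sum>k\<in>paths d n. w k * exp (\<beta> * (\<Sum>r=1..d. path_coeff d k i r * z r))) + \<theta>)"
    for z :: "nat \<Rightarrow> real"
  have G_eq: "cos (u * soft_value d n \<beta> (x(i := z)) + \<theta>) = G z" for z
    by (simp add: soft_value_def G_def w_def path_value_fun_upd[OF i, of _ _ _ z] distrib_left exp_add)
  have "\<exists>p\<^sub>0 p q. \<forall>z. \<bar>G z - (p\<^sub>0 + (\<Sum>r=1..d. p r * z r) + (\<Sum>r=1..d. \<Sum>s=1..d. q r s * (z r * z s)))\<bar>
      \<le> ?K * (\<Sum>r=1..d. \<bar>z r\<bar>) ^ 3"
    unfolding G_def
    by (rule cos_log_sum_exp_taylor[OF finite_paths paths_nonempty _ abs_path_coeff_le \<beta>]) (simp_all add: w_def)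
  then obtain p\<^sub>0 p q where taylor: "\<forall>z. \<bar>G z - (p\<^sub>0 + (\<Sum>r=1..d. p r * z r) + (\<Sum>r=1..d. \<Sum>s=1..d. q r s * (z r * z s)))\<bar>
      \<le> ?K * (\<Sum>r=1..d. \<bar>z r\<bar>) ^ 3"
    by (elim exE)
  have G_meas: "G \<in> borel_measurable (PiM {1..d} (\<lambda>_. borel))"
    unfolding G_def[abs_def] by measurable
  have bound: "\<bar>integral\<^sup>L \<rho> G - (p\<^sub>0 + (\<Sum>r=1..d. \<Sum>s=1..d. q r s * V r s))\<bar> \<le> ?K * (real d ^ 4 * \<kappa>)"
    if "step_law d V \<kappa> \<rho>" for \<rho>
    by (rule integral_quadratic_approx[OF that G_meas, of 1]) (use taylor in \<open>auto simp: G_def\<close>)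
  show ?thesis
    unfolding G_eq using bound[OF \<mu>] bound[OF \<nu>] by linarith
qed

lemma abs_cos_diff_le: "\<bar>cos x - cos y\<bar> \<le> \<bar>x - y\<bar>" for x y :: real
proof -
  have "\<bar>cos x - cos y\<bar> = 2 * \<bar>sin ((x + y) / 2)\<bar> * \<bar>sin ((y - x) / 2)\<bar>"
    by (simp add: cos_diff_cos abs_mult)
  also have "\<dots> \<le> 2 * 1 * \<bar>(y - x) / 2\<bar>"
    by (intro mult_mono abs_sin_x_le_abs_x) auto
  finally show ?thesis by simp
qed

text \<open>The first summand is the cost of passing from the maximum to its smoothing and back, the second one
  is the cost of exchanging \<open>n\<close> steps.\<close>

lemma max_value_comparison:
  assumes \<beta>: "\<beta> \<ge> 1" and \<mu>: "step_law d V \<kappa> \<mu>" and \<nu>: "step_law d V \<kappa> \<nu>"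
  shows "\<bar>(\<integral>x. cos (u * max_value d n x + \<theta>) \<partial>PiM {..<n} (\<lambda>_. \<mu>))
      - (\<integral>x. cos (u * max_value d n x + \<theta>) \<partial>PiM {..<n} (\<lambda>_. \<nu>))\<bar>
    \<le> 2 * \<bar>u\<bar> * (real d * ln (real n + 1) / \<beta>)
      + real n * (2 * ((\<bar>u\<bar> + u\<^sup>2 + \<bar>u\<bar> ^ 3) * \<beta>\<^sup>2 * (real d ^ 4 * \<kappa>)))"
proof -
  let ?S = "PiM {1..d} (\<lambda>_. borel :: real measure)"
  define smooth where "smooth x = cos (u * soft_value d n \<beta> x + \<theta>)" for x
  define sharp where "sharp x = cos (u * max_value d n x + \<theta>)" for x
  have sets: "sets (PiM {..<n} (\<lambda>_. \<rho>)) = sets (PiM {..<n} (\<lambda>_. ?S))" if "step_law d V \<kappa> \<rho>" for \<rho>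
    using that by (intro sets_PiM_cong) (auto simp: step_law_def)
  have meas: "smooth \<in> borel_measurable (PiM {..<n} (\<lambda>_. \<rho>))" "sharp \<in> borel_measurable (PiM {..<n} (\<lambda>_. \<rho>))"
    if "step_law d V \<kappa> \<rho>" for \<rho>
    unfolding measurable_cong_sets[OF sets[OF that] refl] smooth_def[abs_def] sharp_def[abs_def]
    by measurable
  have gap: "\<bar>integral\<^sup>L (PiM {..<n} (\<lambda>_. \<rho>)) smooth - integral\<^sup>L (PiM {..<n} (\<lambda>_. \<rho>)) sharp\<bar>
      \<le> \<bar>u\<bar> * (real d * ln (real n + 1) / \<beta>)" if \<rho>: "step_law d V \<kappa> \<rho>" for \<rho>
  proof -
    interpret \<rho>: prob_space "PiM {..<n} (\<lambda>_. \<rho>)"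
      using \<rho> by (intro prob_space_PiM) (simp add: step_law_def)
    have int: "integrable (PiM {..<n} (\<lambda>_. \<rho>)) smooth" "integrable (PiM {..<n} (\<lambda>_. \<rho>)) sharp"
      using meas[OF \<rho>] by (auto intro!: \<rho>.integrable_const_bound[of _ 1] simp: smooth_def sharp_def)
    have "\<bar>smooth x - sharp x\<bar> \<le> \<bar>u\<bar> * (real d * ln (real n + 1) / \<beta>)" for x
    proof -
      have "\<bar>smooth x - sharp x\<bar> \<le> \<bar>u\<bar> * \<bar>soft_value d n \<beta> x - max_value d n x\<bar>"
        using abs_cos_diff_le[of "u * soft_value d n \<beta> x + \<theta>" "u * max_value d n x + \<theta>"]
        by (simp add: smooth_def sharp_def right_diff_distrib[symmetric] abs_mult)
      also have "\<dots> \<le> \<bar>u\<bar> * (real d * ln (real n + 1) / \<beta>)"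
        using soft_value_bounds[of \<beta> d n x] \<beta> by (intro mult_left_mono) auto
      finally show ?thesis .
    qed
    then have "(\<integral>x. \<bar>smooth x - sharp x\<bar> \<partial>PiM {..<n} (\<lambda>_. \<rho>)) \<le> \<bar>u\<bar> * (real d * ln (real n + 1) / \<beta>)"
      using int by (intro \<rho>.integral_le_const) auto
    moreover have "\<bar>\<integral>x. smooth x - sharp x \<partial>PiM {..<n} (\<lambda>_. \<rho>)\<bar> \<le> (\<integral>x. \<bar>smooth x - sharp x\<bar> \<partial>PiM {..<n} (\<lambda>_. \<rho>))"
      by (rule integral_abs_bound)
    ultimately show ?thesis using int by simp
  qed
  have "\<bar>integral\<^sup>L (PiM {..<n} (\<lambda>_. \<mu>)) smooth - integral\<^sup>L (PiM {..<n} (\<lambda>_. \<nu>)) smooth\<bar>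
      \<le> real (card {..<n}) * (2 * ((\<bar>u\<bar> + u\<^sup>2 + \<bar>u\<bar> ^ 3) * \<beta>\<^sup>2 * (real d ^ 4 * \<kappa>)))"
  proof (rule lindeberg_replacement[of \<mu> \<nu> _ _ 1])
    show "\<bar>(\<integral>z. smooth (x(i := z)) \<partial>\<mu>) - (\<integral>z. smooth (x(i := z)) \<partial>\<nu>)\<bar>
        \<le> 2 * ((\<bar>u\<bar> + u\<^sup>2 + \<bar>u\<bar> ^ 3) * \<beta>\<^sup>2 * (real d ^ 4 * \<kappa>))" if "i \<in> {..<n}" for i x
      using that soft_value_swap[OF _ \<beta> \<mu> \<nu>, of i n u x \<theta>] by (simp add: smooth_def)
  qed (use \<mu> \<nu> meas[OF \<mu>] in \<open>auto simp: step_law_def smooth_def\<close>)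
  then show ?thesis
    using gap[OF \<mu>] gap[OF \<nu>] unfolding sharp_def[symmetric] by simp linarith
qed

text \<open>With \<open>\<beta> = n\<^bsup>1/8\<^esup>\<close> the smoothing costs \<open>O(n\<^bsup>-1/8\<^esup> ln n)\<close> and the exchange of all the steps
  \<open>O(n \<beta>\<^sup>2 n\<^bsup>-3/2\<^esup>) = O(n\<^bsup>-1/4\<^esup>)\<close>.\<close>

lemma max_value_comparison_tendsto:
  assumes \<mu>: "\<And>n. n \<ge> 1 \<Longrightarrow> step_law d (V n) (C * real n powr (- 3 / 2)) (\<mu> n)"
    and \<nu>: "\<And>n. n \<ge> 1 \<Longrightarrow> step_law d (V n) (C * real n powr (- 3 / 2)) (\<nu> n)"
  shows "(\<lambda>n. (\<integral>x. cos (u * max_value d n x + \<theta>) \<partial>PiM {..<n} (\<lambda>_. \<mu> n))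
      - (\<integral>x. cos (u * max_value d n x + \<theta>) \<partial>PiM {..<n} (\<lambda>_. \<nu> n))) \<longlonglongrightarrow> 0"
proof -
  define U where "U = \<bar>u\<bar> + u\<^sup>2 + \<bar>u\<bar> ^ 3"
  let ?g = "\<lambda>n. 2 * \<bar>u\<bar> * (real d * ln (real n + 1) / real n powr (1 / 8))
      + real n * (2 * (U * (real n powr (1 / 8))\<^sup>2 * (real d ^ 4 * (C * real n powr (- 3 / 2)))))"
  have "\<forall>\<^sub>F n in sequentially. norm ((\<integral>x. cos (u * max_value d n x + \<theta>) \<partial>PiM {..<n} (\<lambda>_. \<mu> n))
      - (\<integral>x. cos (u * max_value d n x + \<theta>) \<partial>PiM {..<n} (\<lambda>_. \<nu> n))) \<le> ?g n"
    using eventually_ge_at_top[of 1]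
  proof eventually_elim
    case (elim n)
    then show ?case
      unfolding real_norm_def U_def
      by (intro max_value_comparison[OF _ \<mu> \<nu>]) (auto intro!: ge_one_powr_ge_zero)
  qed
  moreover have "?g \<longlonglongrightarrow> 0"
  proof (rule tendsto_add_zero)
    have "(\<lambda>n. ln (real n + 1) / real n powr (1 / 8)) \<longlonglongrightarrow> 0" by real_asymp
    from tendsto_mult_left[OF this, of "2 * \<bar>u\<bar> * real d"]
    show "(\<lambda>n. 2 * \<bar>u\<bar> * (real d * ln (real n + 1) / real n powr (1 / 8))) \<longlonglongrightarrow> 0"
      by (simp add: mult_ac)
    have "(\<lambda>n. real n * ((real n powr (1 / 8))\<^sup>2 * real n powr (- 3 / 2))) \<longlonglongrightarrow> 0" by real_asymp
    from tendsto_mult_left[OF this, of "2 * U * real d ^ 4 * C"]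
    show "(\<lambda>n. real n * (2 * (U * (real n powr (1 / 8))\<^sup>2 * (real d ^ 4 * (C * real n powr (- 3 / 2)))))) \<longlonglongrightarrow> 0"
      by (simp add: mult_ac)
  qed
  ultimately show ?thesis
    by (rule Lim_null_comparison)
qed

section \<open>Brownian increments over the mesh of width \<open>1 / n\<close>\<close>

text \<open>Only a positive variance has to be considered: a point mass centred at \<open>0\<close> contradicts \<open>v > 0\<close>. The
  exact third absolute moment is \<open>2 sqrt (2 / \<pi>) v\<^bsup>3/2\<^esup>\<close>.\<close>

lemma (in prob_space) centered_normal_moments:
  assumes Y: "random_variable borel Y" and law: "distr M borel Y = normal_law \<mu> \<sigma>" and "\<sigma> \<ge> 0"
    and mean: "expectation Y = 0" and var: "expectation (\<lambda>\<omega>. (Y \<omega>)\<^sup>2) = v" and v: "v > 0"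
  shows "has_bochner_integral M Y 0" "has_bochner_integral M (\<lambda>\<omega>. (Y \<omega>)\<^sup>2) v"
    "integrable M (\<lambda>\<omega>. \<bar>Y \<omega>\<bar> ^ 3)" "expectation (\<lambda>\<omega>. \<bar>Y \<omega>\<bar> ^ 3) \<le> 2 * v powr (3 / 2)"
proof -
  note [measurable] = Y
  have E: "expectation (\<lambda>\<omega>. f (Y \<omega>)) = integral\<^sup>L (normal_law \<mu> \<sigma>) f"
    if "f \<in> borel_measurable borel" for f :: "real \<Rightarrow> real"
    using integral_distr[OF Y that] law by simp
  have \<sigma>: "\<sigma> > 0"
  proof (rule ccontr)
    assume "\<not> \<sigma> > 0"
    then have "\<sigma> = 0" using \<open>\<sigma> \<ge> 0\<close> by simp
    then have "expectation Y = \<mu>" "expectation (\<lambda>\<omega>. (Y \<omega>)\<^sup>2) = \<mu>\<^sup>2"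
      using E[of "\<lambda>x. x"] E[of "\<lambda>x. x\<^sup>2"] by (simp_all add: normal_law_def integral_return)
    then show False using mean var v by simp
  qed
  have has: "has_bochner_integral M (\<lambda>\<omega>. f (Y \<omega>)) c"
    if f: "f \<in> borel_measurable borel" and c: "has_bochner_integral lborel (\<lambda>x. normal_density \<mu> \<sigma> x * f x) c"
    for f :: "real \<Rightarrow> real" and c
  proof -
    have "has_bochner_integral (normal_law \<mu> \<sigma>) f c"
      unfolding normal_law_def using \<sigma> f c by (auto intro!: has_bochner_integral_density)
    then show ?thesis
      using integrable_distr_eq[OF Y f] E[OF f] law by (simp add: has_bochner_integral_iff)
  qed
  have "has_bochner_integral M Y \<mu>"
    using has[of "\<lambda>x. x" \<mu>] normal_moment_nz_1[OF \<sigma>] by simp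
  then have \<mu>: "\<mu> = 0" and m1: "has_bochner_integral M Y 0"
    using mean by (auto simp: has_bochner_integral_iff)
  show "has_bochner_integral M Y 0" by (rule m1)
  have m2: "has_bochner_integral M (\<lambda>\<omega>. (Y \<omega>)\<^sup>2) (\<sigma>\<^sup>2)"
    using has[of "\<lambda>x. x\<^sup>2" "\<sigma>\<^sup>2"] normal_moment_even[OF \<sigma>, of \<mu> 1] by (simp add: \<mu>)
  then have \<sigma>v: "\<sigma>\<^sup>2 = v"
    using var by (simp add: has_bochner_integral_iff)
  then show "has_bochner_integral M (\<lambda>\<omega>. (Y \<omega>)\<^sup>2) v" using m2 by simp
  have m3: "has_bochner_integral M (\<lambda>\<omega>. \<bar>Y \<omega>\<bar> ^ 3) (2 * \<sigma> ^ 3 * sqrt (2 / pi))"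
    using has[of "\<lambda>x. \<bar>x\<bar> ^ 3"] normal_moment_abs_odd[OF \<sigma>, of \<mu> 1] by (simp add: \<mu>)
  then show "integrable M (\<lambda>\<omega>. \<bar>Y \<omega>\<bar> ^ 3)"
    by (simp add: has_bochner_integral_iff)
  have "sqrt (2 / pi) \<le> 1"
    using pi_gt3 by simp
  moreover have "v powr (3 / 2) = \<sigma> ^ 3"
  proof -
    have "v powr (3 / 2) = (\<sigma> powr 2) powr (3 / 2)" using \<sigma> \<sigma>v by simp
    also have "\<dots> = \<sigma> powr 3" by (simp only: powr_powr) simp
    also have "\<dots> = \<sigma> ^ 3" using \<sigma> by simp
    finally show ?thesis .
  qed
  ultimately have "2 * \<sigma> ^ 3 * sqrt (2 / pi) \<le> 2 * v powr (3 / 2)"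
    using \<sigma> by (simp add: mult_left_le)
  then show "expectation (\<lambda>\<omega>. \<bar>Y \<omega>\<bar> ^ 3) \<le> 2 * v powr (3 / 2)"
    using m3 by (simp add: has_bochner_integral_iff)
qed

lemma step_law_mono: "step_law d V \<kappa> \<mu> \<Longrightarrow> \<kappa> \<le> \<kappa>' \<Longrightarrow> step_law d V \<kappa>' \<mu>"
  unfolding step_law_def by force

context brownian_motion
begin

definition increment_law :: "nat \<Rightarrow> (nat \<Rightarrow> real) measure" where
  "increment_law n = distr N (PiM {1..d} (\<lambda>_. borel)) (\<lambda>\<omega>. \<lambda>r\<in>{1..d}. B r (1 / real n) \<omega> - B r 0 \<omega>)"

lemma step_law_increment_law:
  assumes diag: "\<And>r. r \<in> {1..d} \<Longrightarrow> M r r = 1" and n: "n \<ge> 1"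
  shows "step_law d (\<lambda>r s. M r s / real n) (2 * real n powr (- 3 / 2)) (increment_law n)"
proof -
  let ?t = "1 / real n"
  have t: "?t \<in> {0..1}" using n by simp
  have Bm [measurable]: "random_variable borel (B r ?t)" if "r \<in> {1..d}" for r
    using random_variable[OF that t] .
  have rv: "(\<lambda>\<omega>. \<lambda>r\<in>{1..d}. B r ?t \<omega> - B r 0 \<omega>) \<in> measurable N (PiM {1..d} (\<lambda>_. borel))"
    by (intro measurable_restrict borel_measurable_diff random_variable) (use t in auto)
  have law: "\<exists>\<mu> \<sigma>. \<sigma> \<ge> 0 \<and> distr N borel (B r ?t) = normal_law \<mu> \<sigma>" if r: "r \<in> {1..d}" for r
    using gaussian[of "{(r, ?t)}" "\<lambda>_. 1"] r t by simp
  have var: "expectation (\<lambda>\<omega>. (B r ?t \<omega>)\<^sup>2) = ?t" if r: "r \<in> {1..d}" for r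
    using covariance[OF r r t] diag[OF r] by (simp add: power2_eq_square)
  have m1: "has_bochner_integral N (B r ?t) 0"
    and m2: "has_bochner_integral N (\<lambda>\<omega>. (B r ?t \<omega>)\<^sup>2) ?t"
    and m3: "integrable N (\<lambda>\<omega>. \<bar>B r ?t \<omega>\<bar> ^ 3)" "expectation (\<lambda>\<omega>. \<bar>B r ?t \<omega>\<bar> ^ 3) \<le> 2 * ?t powr (3 / 2)"
    if r: "r \<in> {1..d}" for r
    using law[OF r] centered_normal_moments[OF Bm[OF r] _ _ centered[OF r t] var[OF r]] n
    by auto
  have m12: "has_bochner_integral N (\<lambda>\<omega>. B r ?t \<omega> * B s ?t \<omega>) (M r s / real n)"
    if r: "r \<in> {1..d}" and s: "s \<in> {1..d}" for r s
  proof -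
    \<comment> \<open>The Bochner integral of a non-integrable function is \<open>0\<close>, so the value of the expectation alone is not enough.\<close>
    have "integrable N (\<lambda>\<omega>. (B r ?t \<omega>)\<^sup>2 + (B s ?t \<omega>)\<^sup>2)"
      using m2[OF r] m2[OF s] by (auto simp: has_bochner_integral_iff)
    then have "integrable N (\<lambda>\<omega>. B r ?t \<omega> * B s ?t \<omega>)"
    proof (rule Bochner_Integration.integrable_bound)
      show "(\<lambda>\<omega>. B r ?t \<omega> * B s ?t \<omega>) \<in> borel_measurable N" using r s by measurable
      have "\<bar>x * y\<bar> \<le> x\<^sup>2 + y\<^sup>2" for x y :: real
        using sum_squares_bound[of "\<bar>x\<bar>" "\<bar>y\<bar>"] mult_nonneg_nonneg[of "\<bar>x\<bar>" "\<bar>y\<bar>"]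
        unfolding abs_mult power2_abs by linarith
      then show "AE \<omega> in N. norm (B r ?t \<omega> * B s ?t \<omega>) \<le> norm ((B r ?t \<omega>)\<^sup>2 + (B s ?t \<omega>)\<^sup>2)"
        by simp
    qed
    then show ?thesis
      using covariance[OF r s t] by (simp add: has_bochner_integral_iff)
  qed
  have transfer: "has_bochner_integral (increment_law n) f c"
    if f: "f \<in> borel_measurable (PiM {1..d} (\<lambda>_. borel))"
      and c: "has_bochner_integral N (\<lambda>\<omega>. f (\<lambda>r\<in>{1..d}. B r ?t \<omega>)) c" for f :: "(nat \<Rightarrow> real) \<Rightarrow> real" and c
    unfolding increment_law_def
  proof (rule has_bochner_integral_distr[OF f rv])
    have "f (\<lambda>r\<in>{1..d}. B r ?t \<omega> - B r 0 \<omega>) = f (\<lambda>r\<in>{1..d}. B r ?t \<omega>)" if "\<omega> \<in> space N" for \<omega>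
      using start[OF _ that] by (intro arg_cong[of _ _ f]) (auto simp: restrict_def)
    then show "has_bochner_integral N (\<lambda>\<omega>. f (\<lambda>r\<in>{1..d}. B r ?t \<omega> - B r 0 \<omega>)) c"
      using c by (subst has_bochner_integral_cong[OF refl _ refl]) auto
  qed
  have comp: "(\<lambda>z. z r) \<in> borel_measurable (PiM {1..d} (\<lambda>_. borel :: real measure))" if "r \<in> {1..d}" for r
    using that by (rule measurable_component_singleton)
  have scale: "?t powr (3 / 2) = real n powr (- 3 / 2)"
    using n by (simp add: powr_divide powr_minus field_simps)
  have m3': "integrable (increment_law n) (\<lambda>z. \<bar>z r\<bar> ^ 3) \<and>
      (\<integral>z. \<bar>z r\<bar> ^ 3 \<partial>increment_law n) \<le> 2 * real n powr (- 3 / 2)" if r: "r \<in> {1..d}" for r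
  proof -
    have "has_bochner_integral (increment_law n) (\<lambda>z. \<bar>z r\<bar> ^ 3) (expectation (\<lambda>\<omega>. \<bar>B r ?t \<omega>\<bar> ^ 3))"
      using r m3(1)[OF r] comp[OF r] by (intro transfer) (auto simp: has_bochner_integral_iff)
    then show ?thesis
      using m3(2)[OF r] unfolding scale by (auto simp: has_bochner_integral_iff)
  qed
  show ?thesis
    unfolding step_law_def
  proof (intro conjI ballI)
    show "prob_space (increment_law n)"
      unfolding increment_law_def by (rule prob_space_distr[OF rv])
    show "has_bochner_integral (increment_law n) (\<lambda>z. z r) 0" if "r \<in> {1..d}" for r
      using that m1 comp by (intro transfer) auto
    show "has_bochner_integral (increment_law n) (\<lambda>z. z r * z s) (M r s / real n)"
      if "r \<in> {1..d}" "s \<in> {1..d}" for r s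
      using that m12 comp by (intro transfer borel_measurable_times) auto
  qed (use m3' in \<open>auto simp: increment_law_def\<close>)
qed

text \<open>Independence of the increments over the mesh \<open>l / n\<close> gives a product law, and stationarity makes its
  factors equal.\<close>

lemma increments_iid:
  assumes n: "n \<ge> 1"
  shows "(\<lambda>\<omega>. \<lambda>l\<in>{..<n}. \<lambda>r\<in>{1..d}. B r (real (Suc l) / real n) \<omega> - B r (real l / real n) \<omega>)
      \<in> measurable N (PiM {..<n} (\<lambda>_. PiM {1..d} (\<lambda>_. borel)))" (is "?W \<in> _")
    and "distr N (PiM {..<n} (\<lambda>_. PiM {1..d} (\<lambda>_. borel)))
      (\<lambda>\<omega>. \<lambda>l\<in>{..<n}. \<lambda>r\<in>{1..d}. B r (real (Suc l) / real n) \<omega> - B r (real l / real n) \<omega>)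
    = PiM {..<n} (\<lambda>_. increment_law n)"
proof -
  let ?D = "\<lambda>l \<omega>. \<lambda>r\<in>{1..d}. B r (real (Suc l) / real n) \<omega> - B r (real l / real n) \<omega>"
  have rv: "?D l \<in> measurable N (PiM {1..d} (\<lambda>_. borel))" if "l \<in> {..<n}" for l
    by (intro measurable_restrict borel_measurable_diff random_variable)
       (use that n in \<open>auto simp: field_simps\<close>)
  then show "?W \<in> measurable N (PiM {..<n} (\<lambda>_. PiM {1..d} (\<lambda>_. borel)))"
    by (rule measurable_restrict)
  have "indep_vars (\<lambda>_. PiM {1..d} (\<lambda>_. borel)) ?D {..<n}"
    using n by (intro independent_increments) (auto simp: monotone_on_def field_simps)
  then have "distr N (PiM {..<n} (\<lambda>_. PiM {1..d} (\<lambda>_. borel))) ?W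
    = PiM {..<n} (\<lambda>l. distr N (PiM {1..d} (\<lambda>_. borel)) (?D l))"
    using n rv by (subst (asm) indep_vars_iff_distr_eq_PiM') (auto simp: lessThan_empty_iff)
  also have "\<dots> = PiM {..<n} (\<lambda>_. increment_law n)"
  proof (intro PiM_cong refl)
    fix l assume "l \<in> {..<n}"
    then have "real l / real n + 1 / real n \<le> 1" "real l / real n + 1 / real n = real (Suc l) / real n"
      by (auto simp: field_simps)
    then show "distr N (PiM {1..d} (\<lambda>_. borel)) (?D l) = increment_law n"
      using stationary_increments[of "real l / real n" "1 / real n"] by (simp add: increment_law_def)
  qed
  finally show "distr N (PiM {..<n} (\<lambda>_. PiM {1..d} (\<lambda>_. borel))) ?W = PiM {..<n} (\<lambda>_. increment_law n)" .
qed

end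

text \<open>Both sums over the steps telescope: up to \<open>k r\<close> they give the value at time \<open>k r / n\<close>, and in full they
  give the value at time \<open>1\<close>.\<close>

lemma path_value_increments:
  fixes f :: "nat \<Rightarrow> real \<Rightarrow> real"
  assumes n: "n \<ge> 1" and k: "k \<in> paths d n" and f0: "\<And>r. r \<in> {1..d} \<Longrightarrow> f r 0 = 0"
  shows "path_value d n k (\<lambda>l\<in>{..<n}. \<lambda>r\<in>{1..d}. f r (real (Suc l) / real n) - f r (real l / real n))
    = - (1 / real (d + 1)) * (\<Sum>r=1..d. real r * f r 1) + (\<Sum>r=1..d. f r (real (k r) / real n))"
proof -
  let ?\<Delta> = "\<lambda>l r. f r (real (Suc l) / real n) - f r (real l / real n)"
  have "path_value d n k (\<lambda>l\<in>{..<n}. \<lambda>r\<in>{1..d}. ?\<Delta> l r) = (\<Sum>l<n. \<Sum>r=1..d. path_coeff d k l r * ?\<Delta> l r)"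
    unfolding path_value_def by (intro sum.cong refl) auto
  also have "\<dots> = (\<Sum>r=1..d. \<Sum>l<n. path_coeff d k l r * ?\<Delta> l r)"
    by (rule sum.swap)
  also have "\<dots> = (\<Sum>r=1..d. f r (real (k r) / real n) - real r / real (d + 1) * f r 1)"
  proof (rule sum.cong[OF refl])
    fix r assume r: "r \<in> {1..d}"
    have kn: "k r \<le> n" using k r by (auto simp: paths_def)
    have tele: "(\<Sum>l<j. ?\<Delta> l r) = f r (real j / real n)" for j
      using sum_lessThan_telescope[of "\<lambda>l. f r (real l / real n)" j] f0[OF r] by simp
    have "(\<Sum>l<n. path_coeff d k l r * ?\<Delta> l r)
      = (\<Sum>l<n. of_bool (l < k r) * ?\<Delta> l r) - real r / real (d + 1) * (\<Sum>l<n. ?\<Delta> l r)"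
      unfolding path_coeff_def left_diff_distrib sum_distrib_left
      by (rule trans[OF _ sum_subtractf]) (simp only: left_diff_distrib)
    also have "(\<Sum>l<n. of_bool (l < k r) * ?\<Delta> l r) = (\<Sum>l<k r. ?\<Delta> l r)"
      using kn by (intro sum.mono_neutral_cong_right) auto
    finally show "(\<Sum>l<n. path_coeff d k l r * ?\<Delta> l r) = f r (real (k r) / real n) - real r / real (d + 1) * f r 1"
      using n unfolding tele by simp
  qed
  also have "\<dots> = - (1 / real (d + 1)) * (\<Sum>r=1..d. real r * f r 1) + (\<Sum>r=1..d. f r (real (k r) / real n))"
    by (simp add: sum_subtractf sum_distrib_left sum_negf)
  finally show ?thesis .
qed

lemma floor_grid_tendsto:
  fixes t :: real
  assumes "t \<in> {0..1}"
  shows "(\<lambda>n. real (nat \<lfloor>real n * t\<rfloor>) / real n) \<longlonglongrightarrow> t"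
proof (rule tendsto_sandwich)
  show "\<forall>\<^sub>F n in sequentially. t - 1 / real n \<le> real (nat \<lfloor>real n * t\<rfloor>) / real n"
    using eventually_gt_at_top[of 0]
  proof eventually_elim
    case (elim n)
    have "real n * t - 1 \<le> real (nat \<lfloor>real n * t\<rfloor>)" by linarith
    then have "(real n * t - 1) / real n \<le> real (nat \<lfloor>real n * t\<rfloor>) / real n"
      by (rule divide_right_mono) simp
    then show ?case using elim by (simp add: diff_divide_distrib)
  qed
  show "\<forall>\<^sub>F n in sequentially. real (nat \<lfloor>real n * t\<rfloor>) / real n \<le> t"
    using eventually_gt_at_top[of 0]
  proof eventually_elim
    case (elim n)
    have "0 \<le> real n * t" using assms by simp
    then have "real (nat \<lfloor>real n * t\<rfloor>) \<le> real n * t" by linarith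
    then show ?case using elim by (simp add: field_simps)
  qed
  show "(\<lambda>n. t - 1 / real n) \<longlonglongrightarrow> t"
    using tendsto_diff[OF tendsto_const lim_1_over_n, of t] by simp
qed simp

text \<open>Every path gives ordered times \<open>k r / n\<close>, so that the maximum over paths stays below the supremum.
  In the other direction, round a maximising vector of times down to the mesh.\<close>

lemma max_value_increments_tendsto:
  fixes f :: "nat \<Rightarrow> real \<Rightarrow> real"
  assumes cont: "\<And>r. r \<in> {1..d} \<Longrightarrow> continuous_on {0..1} (f r)"
    and f0: "\<And>r. r \<in> {1..d} \<Longrightarrow> f r 0 = 0"
  shows "(\<lambda>n. max_value d n (\<lambda>l\<in>{..<n}. \<lambda>r\<in>{1..d}. f r (real (Suc l) / real n) - f r (real l / real n)))
    \<longlonglongrightarrow> - (1 / real (d + 1)) * (\<Sum>r=1..d. real r * f r 1) + (SUP t\<in>ordered_times d. \<Sum>r=1..d. f r (t r))"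
    (is "?L \<longlonglongrightarrow> ?c + ?S")
proof -
  obtain t where t: "t \<in> ordered_times d" "(\<Sum>r=1..d. f r (t r)) = ?S"
    and max: "\<forall>u\<in>ordered_times d. (\<Sum>r=1..d. f r (u r)) \<le> (\<Sum>r=1..d. f r (t r))"
    using SUP_ordered_times_attained[of d f, OF cont] by blast
  have t01: "t r \<in> {0..1}" if "r \<in> {1..d}" for r
    using t(1) that by (auto simp: ordered_times_def)
  define \<kappa> where "\<kappa> n = (\<lambda>r\<in>{1..d}. nat \<lfloor>real n * t r\<rfloor>)" for n :: nat
  have \<kappa>: "\<kappa> n \<in> paths d n" for n
    unfolding paths_def
  proof (intro CollectI conjI mono_onI PiE_I)
    show "\<kappa> n r \<in> {0..n}" if r: "r \<in> {1..d}" for r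
    proof -
      have "real n * t r \<le> real n" using t01[OF r] by (simp add: mult_left_le)
      then have "nat \<lfloor>real n * t r\<rfloor> \<le> n" by linarith
      then show ?thesis using r by (simp add: \<kappa>_def)
    qed
    show "\<kappa> n r \<le> \<kappa> n s" if rs: "r \<in> {1..d}" "s \<in> {1..d}" "r \<le> s" for r s
    proof -
      have "t r \<le> t s" using t(1) rs by (auto simp: ordered_times_def monotone_on_def)
      then show ?thesis
        using rs by (auto simp: \<kappa>_def intro!: nat_mono floor_mono mult_left_mono)
    qed
  qed (auto simp: \<kappa>_def)
  show ?thesis
  proof (rule tendsto_sandwich)
    show "\<forall>\<^sub>F n in sequentially. ?c + (\<Sum>r=1..d. f r (real (\<kappa> n r) / real n)) \<le> ?L n"
      using eventually_ge_at_top[of 1]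
    proof eventually_elim
      case (elim n)
      have "path_value d n (\<kappa> n) (\<lambda>l\<in>{..<n}. \<lambda>r\<in>{1..d}. f r (real (Suc l) / real n) - f r (real l / real n)) \<le> ?L n"
        unfolding max_value_def by (intro Max_ge finite_imageI imageI finite_paths \<kappa>)
      moreover have "path_value d n (\<kappa> n) (\<lambda>l\<in>{..<n}. \<lambda>r\<in>{1..d}. f r (real (Suc l) / real n) - f r (real l / real n))
          = ?c + (\<Sum>r=1..d. f r (real (\<kappa> n r) / real n))"
        by (rule path_value_increments[where f = f, OF elim \<kappa>[of n] f0])
      ultimately show ?case by simp
    qed
    show "\<forall>\<^sub>F n in sequentially. ?L n \<le> ?c + ?S"
      using eventually_ge_at_top[of 1]
    proof eventually_elim
      case (elim n)
      have "path_value d n k (\<lambda>l\<in>{..<n}. \<lambda>r\<in>{1..d}. f r (real (Suc l) / real n) - f r (real l / real n)) \<le> ?c + ?S"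
        if k: "k \<in> paths d n" for k
      proof -
        have "(\<lambda>r. real (k r) / real n) \<in> ordered_times d"
          using k elim by (auto simp: ordered_times_def paths_def monotone_on_def PiE_iff divide_right_mono field_simps)
        from bspec[OF max this] have "(\<Sum>r=1..d. f r (real (k r) / real n)) \<le> ?S"
          unfolding t(2) .
        moreover have "path_value d n k (\<lambda>l\<in>{..<n}. \<lambda>r\<in>{1..d}. f r (real (Suc l) / real n) - f r (real l / real n))
            = ?c + (\<Sum>r=1..d. f r (real (k r) / real n))"
          by (rule path_value_increments[where f = f, OF elim k f0])
        ultimately show ?thesis by simp
      qed
      then show ?case
        unfolding max_value_def by (intro Max.boundedI) auto
    qed
    have "(\<lambda>n. \<Sum>r=1..d. f r (real (\<kappa> n r) / real n)) \<longlonglongrightarrow> (\<Sum>r=1..d. f r (t r))"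
    proof (rule tendsto_sum)
      fix r assume r: "r \<in> {1..d}"
      show "(\<lambda>n. f r (real (\<kappa> n r) / real n)) \<longlonglongrightarrow> f r (t r)"
      proof (rule continuous_on_tendsto_compose[OF cont[OF r] _ t01[OF r]])
        show "(\<lambda>n. real (\<kappa> n r) / real n) \<longlonglongrightarrow> t r"
          using floor_grid_tendsto[OF t01[OF r]] r by (simp add: \<kappa>_def)
        show "\<forall>\<^sub>F n in sequentially. real (\<kappa> n r) / real n \<in> {0..1}"
          using eventually_gt_at_top[of 0]
        proof eventually_elim
          case (elim n)
          have "\<kappa> n r \<le> n" using \<kappa>[of n] r by (auto simp: paths_def)
          then show ?case using elim by simp
        qed
      qed
    qed
    then show "(\<lambda>n. ?c + (\<Sum>r=1..d. f r (real (\<kappa> n r) / real n))) \<longlonglongrightarrow> ?c + ?S"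
      unfolding t(2)[symmetric] by (intro tendsto_add tendsto_const)
  qed simp
qed

context brownian_motion
begin

definition limit_functional :: "'b \<Rightarrow> real" where
  "limit_functional \<omega> = - (1 / real (d + 1)) * (\<Sum>r=1..d. real r * B r 1 \<omega>)
     + (SUP t\<in>ordered_times d. \<Sum>r=1..d. B r (t r) \<omega>)"

definition grid_functional :: "nat \<Rightarrow> 'b \<Rightarrow> real" where
  "grid_functional n \<omega> = max_value d n
     (\<lambda>l\<in>{..<n}. \<lambda>r\<in>{1..d}. B r (real (Suc l) / real n) \<omega> - B r (real l / real n) \<omega>)"

lemma grid_functional_tendsto:
  assumes "\<omega> \<in> space N"
  shows "(\<lambda>n. grid_functional n \<omega>) \<longlonglongrightarrow> limit_functional \<omega>"
  unfolding grid_functional_def limit_functional_def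
  using max_value_increments_tendsto[of d "\<lambda>r t. B r t \<omega>"] continuous_paths[OF _ assms] start[OF _ assms]
  by simp

lemma measurable_grid_functional:
  assumes "n \<ge> 1"
  shows "random_variable borel (grid_functional n)"
  unfolding grid_functional_def[abs_def]
  using measurable_compose[OF increments_iid(1)[OF assms] measurable_max_value] .

text \<open>The supremum ranges over an uncountable set; its measurability comes from the approximation by
  maxima over finitely many paths.\<close>

lemma measurable_limit_functional: "random_variable borel limit_functional"
proof (rule borel_measurable_LIMSEQ_real)
  show "(\<lambda>n. grid_functional (Suc n) \<omega>) \<longlonglongrightarrow> limit_functional \<omega>" if "\<omega> \<in> space N" for \<omega>
    using LIMSEQ_Suc[OF grid_functional_tendsto[OF that]] .
  show "random_variable borel (grid_functional (Suc n))" for n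
    by (rule measurable_grid_functional) simp
qed

lemma expectation_increment_law:
  fixes g :: "real \<Rightarrow> real"
  assumes n: "n \<ge> 1" and g: "g \<in> borel_measurable borel"
  shows "(\<integral>x. g (max_value d n x) \<partial>PiM {..<n} (\<lambda>_. increment_law n)) = expectation (\<lambda>\<omega>. g (grid_functional n \<omega>))"
  unfolding increments_iid(2)[OF n, symmetric] grid_functional_def
  by (rule integral_distr[OF increments_iid(1)[OF n] measurable_compose[OF measurable_max_value g]])

text \<open>The integrands are bounded by \<open>1\<close> and converge pointwise, since every sample path is continuous.\<close>

lemma expectation_cos_grid_tendsto:
  "(\<lambda>n. expectation (\<lambda>\<omega>. cos (u * grid_functional n \<omega> + \<theta>))) \<longlonglongrightarrow> expectation (\<lambda>\<omega>. cos (u * limit_functional \<omega> + \<theta>))"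
proof (rule LIMSEQ_imp_Suc, rule integral_dominated_convergence[where w = "\<lambda>_. 1"])
  note [measurable] = measurable_limit_functional measurable_grid_functional
  show "random_variable borel (\<lambda>\<omega>. cos (u * limit_functional \<omega> + \<theta>))" by measurable
  show "random_variable borel (\<lambda>\<omega>. cos (u * grid_functional (Suc n) \<omega> + \<theta>))" for n by measurable
  show "AE \<omega> in N. (\<lambda>n. cos (u * grid_functional (Suc n) \<omega> + \<theta>)) \<longlonglongrightarrow> cos (u * limit_functional \<omega> + \<theta>)"
    using LIMSEQ_Suc[OF grid_functional_tendsto] by (intro AE_I2 tendsto_intros)
qed auto

end

section \<open>Steps of a uniform random word\<close>

definition letter_rank :: "'c::linorder set \<Rightarrow> 'c \<Rightarrow> nat" where
  "letter_rank A c = card {a \<in> A. a \<le> c}"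

lemma letter_rank_le_iff:
  assumes "finite A" "b \<in> A" "c \<in> A"
  shows "letter_rank A b \<le> letter_rank A c \<longleftrightarrow> b \<le> c"
proof (cases "b \<le> c")
  case True
  then have "letter_rank A b \<le> letter_rank A c"
    unfolding letter_rank_def using assms(1) by (intro card_mono) auto
  then show ?thesis using True by simp
next
  case False
  have "letter_rank A c < letter_rank A b"
    unfolding letter_rank_def using assms False by (intro psubset_card_mono) auto
  then show ?thesis using False by simp
qed

lemma bij_betw_letter_rank:
  assumes "finite A"
  shows "bij_betw (letter_rank A) A {1..card A}"
proof -
  have "inj_on (letter_rank A) A"
    using letter_rank_le_iff[OF assms] by (metis inj_onI order.antisym order.refl)
  moreover have "letter_rank A ` A \<subseteq> {1..card A}"
  proof
    fix j assume "j \<in> letter_rank A ` A"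
    then obtain c where c: "c \<in> A" "j = card {a \<in> A. a \<le> c}"
      by (auto simp: letter_rank_def)
    have "card {c} \<le> j"
      unfolding c(2) using assms c(1) by (intro card_mono) auto
    moreover have "j \<le> card A"
      unfolding c(2) using assms by (intro card_mono) auto
    ultimately show "j \<in> {1..card A}" by simp
  qed
  ultimately show ?thesis
    by (simp add: bij_betw_def card_image card_subset_eq)
qed

text \<open>The step that the letter \<open>c\<close> contributes to the walk counting letters of rank \<open>r\<close> minus letters of
  rank \<open>r + 1\<close>.\<close>

definition letter_step :: "'c::linorder set \<Rightarrow> 'c \<Rightarrow> nat \<Rightarrow> real" where
  "letter_step A c r = of_bool (letter_rank A c = r) - of_bool (letter_rank A c = Suc r)"

definition letter_step_law :: "'c::linorder set \<Rightarrow> nat \<Rightarrow> (nat \<Rightarrow> real) measure" where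
  "letter_step_law A n = distr (uniform_count_measure A) (PiM {1..card A - 1} (\<lambda>_. borel))
     (\<lambda>c. \<lambda>r\<in>{1..card A - 1}. letter_step A c r / sqrt (2 * real n / real (card A)))"

lemma sum_rank_steps:
  assumes "finite A"
  shows "(\<Sum>c\<in>A. g (letter_rank A c)) = (\<Sum>j=1..card A. g j)"
  using sum.reindex_bij_betw[OF bij_betw_letter_rank[OF assms], of g] .

lemma sum_letter_step:
  assumes "finite A" "r \<in> {1..card A - 1}"
  shows "(\<Sum>c\<in>A. letter_step A c r) = 0"
proof -
  have "(\<Sum>c\<in>A. letter_step A c r) = (\<Sum>j=1..card A. of_bool (j = r) - of_bool (j = Suc r))"
    unfolding letter_step_def by (rule sum_rank_steps[OF assms(1), of "\<lambda>j. of_bool (j = r) - of_bool (j = Suc r)"])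
  also have "\<dots> = 0"
    using assms(2) by (simp add: sum_subtractf of_bool_def) auto
  finally show ?thesis .
qed

text \<open>Only letters of rank \<open>r\<close> or \<open>r + 1\<close> contribute, and neighbouring coordinates share exactly one such
  rank, at which their steps have opposite signs.\<close>

lemma sum_letter_step_product:
  assumes "finite A" "r \<in> {1..card A - 1}" "s \<in> {1..card A - 1}"
  shows "(\<Sum>c\<in>A. letter_step A c r * letter_step A c s) = 2 * tridiag r s"
proof -
  have "(\<Sum>c\<in>A. letter_step A c r * letter_step A c s)
    = (\<Sum>j=1..card A. (of_bool (j = r) - of_bool (j = Suc r)) * (of_bool (j = s) - of_bool (j = Suc s)))"
    unfolding letter_step_def
    by (rule sum_rank_steps[OF assms(1),
          of "\<lambda>j. (of_bool (j = r) - of_bool (j = Suc r)) * (of_bool (j = s) - of_bool (j = Suc s))"])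
  also have "\<dots> = (\<Sum>j=1..card A. (if j = r then of_bool (r = s) - of_bool (r = Suc s) else 0)
      + (if j = Suc r then of_bool (r = s) - of_bool (Suc r = s) else 0))"
    by (intro sum.cong) auto
  also have "\<dots> = (of_bool (r = s) - of_bool (r = Suc s)) + (of_bool (r = s) - of_bool (Suc r = s))"
  proof -
    have "r \<in> {1..card A}" "Suc r \<in> {1..card A}" using assms(2) by auto
    then show ?thesis by (simp only: sum.distrib sum.delta finite_atLeastAtMost if_True)
  qed
  also have "\<dots> = 2 * tridiag r s"
    by (auto simp: tridiag_def)
  finally show ?thesis .
qed

text \<open>Under the uniform law the steps have covariance \<open>(2 / m) tridiag\<close>; dividing them by \<open>sqrt (2 n / m)\<close>
  turns this into \<open>tridiag / n\<close>, the covariance of the Brownian increments. A step is at most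
  \<open>1 / sqrt (2 n / m)\<close> in absolute value, which bounds the third moment.\<close>

lemma step_law_letter_step_law:
  assumes "finite A" and A: "card A \<ge> 2" and n: "n \<ge> 1" and C: "C \<ge> (real (card A) / 2) powr (3 / 2)"
  shows "step_law (card A - 1) (\<lambda>r s. tridiag r s / real n) (C * real n powr (- 3 / 2)) (letter_step_law A n)"
proof -
  let ?m = "card A" let ?d = "card A - 1"
  define q where "q = sqrt (2 * real n / real ?m)"
  have q: "q > 0" "q\<^sup>2 = 2 * real n / real ?m"
    using n A by (simp_all add: q_def)
  have ne: "A \<noteq> {}" using A by auto
  have rv: "(\<lambda>c. \<lambda>r\<in>{1..?d}. letter_step A c r / q) \<in> measurable (uniform_count_measure A) (PiM {1..?d} (\<lambda>_. borel))"
    by (intro measurable_restrict) (simp add: measurable_def sets_uniform_count_measure space_uniform_count_measure)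
  have transfer: "has_bochner_integral (letter_step_law A n) f ((\<Sum>c\<in>A. f (\<lambda>r\<in>{1..?d}. letter_step A c r / q)) / real ?m)"
    if f: "f \<in> borel_measurable (PiM {1..?d} (\<lambda>_. borel))" for f :: "(nat \<Rightarrow> real) \<Rightarrow> real"
    unfolding letter_step_law_def q_def[symmetric]
  proof (rule has_bochner_integral_distr[OF f rv])
    show "has_bochner_integral (uniform_count_measure A) (\<lambda>c. f (\<lambda>r\<in>{1..?d}. letter_step A c r / q))
      ((\<Sum>c\<in>A. f (\<lambda>r\<in>{1..?d}. letter_step A c r / q)) / real ?m)"
      using assms(1) integrable_point_measure_finite[OF assms(1), of "\<lambda>_. 1 / real ?m"]
      by (simp add: has_bochner_integral_iff integral_uniform_count_measure)
        (simp add: uniform_count_measure_def)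
  qed
  have comp: "(\<lambda>z. z r) \<in> borel_measurable (PiM {1..?d} (\<lambda>_. borel :: real measure))" if "r \<in> {1..?d}" for r
    using that by (rule measurable_component_singleton)
  show ?thesis
    unfolding step_law_def
  proof (intro conjI ballI)
    show "prob_space (letter_step_law A n)"
      unfolding letter_step_law_def q_def[symmetric]
      by (rule prob_space.prob_space_distr[OF prob_space_uniform_count_measure[OF assms(1) ne] rv])
    show "has_bochner_integral (letter_step_law A n) (\<lambda>z. z r) 0" if r: "r \<in> {1..?d}" for r
      using transfer[OF comp[OF r]] r sum_letter_step[OF assms(1) r]
      by (simp add: sum_divide_distrib[symmetric])
    show "has_bochner_integral (letter_step_law A n) (\<lambda>z. z r * z s) (tridiag r s / real n)"
      if r: "r \<in> {1..?d}" and s: "s \<in> {1..?d}" for r s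
    proof -
      have "(\<Sum>c\<in>A. letter_step A c r / q * (letter_step A c s / q)) / real ?m
          = (\<Sum>c\<in>A. letter_step A c r * letter_step A c s) / q\<^sup>2 / real ?m"
        by (simp add: sum_divide_distrib[symmetric] power2_eq_square)
      also have "\<dots> = tridiag r s / real n"
        using A by (simp add: sum_letter_step_product[OF assms(1) r s] q(2))
      finally show ?thesis
        using transfer[OF borel_measurable_times[OF comp[OF r] comp[OF s]]] r s by simp
    qed
    fix r assume r: "r \<in> {1..?d}"
    have meas: "(\<lambda>z. \<bar>z r\<bar> ^ 3) \<in> borel_measurable (PiM {1..?d} (\<lambda>_. borel :: real measure))"
      using comp[OF r] by measurable
    show "integrable (letter_step_law A n) (\<lambda>z. \<bar>z r\<bar> ^ 3)"
      using transfer[OF meas] by (simp add: has_bochner_integral_iff)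
    have "(\<integral>z. \<bar>z r\<bar> ^ 3 \<partial>letter_step_law A n) = (\<Sum>c\<in>A. \<bar>letter_step A c r / q\<bar> ^ 3) / real ?m"
      using transfer[OF meas] r by (simp add: has_bochner_integral_iff)
    also have "\<dots> \<le> (\<Sum>c\<in>A. (1 / q) ^ 3) / real ?m"
    proof (intro divide_right_mono sum_mono power_mono)
      show "\<bar>letter_step A c r / q\<bar> \<le> 1 / q" for c
        using q(1) by (auto simp: letter_step_def abs_if intro!: divide_right_mono)
    qed auto
    also have "\<dots> = (1 / q) ^ 3"
      using A by simp
    also have "\<dots> = (real ?m / 2) powr (3 / 2) * real n powr (- 3 / 2)"
    proof -
      have root: "1 / q = ((real ?m / 2) * (1 / real n)) powr (1 / 2)"
        using n A by (simp add: q_def powr_half_sqrt real_sqrt_divide real_sqrt_mult)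
      have "(1 / q) ^ 3 = (1 / q) powr 3" using q(1) by simp
      also have "\<dots> = (((real ?m / 2) * (1 / real n)) powr (1 / 2)) powr 3"
        unfolding root ..
      also have "\<dots> = ((real ?m / 2) * (1 / real n)) powr (3 / 2)"
        by (simp only: powr_powr) simp
      also have "\<dots> = (real ?m / 2) powr (3 / 2) * (1 / real n) powr (3 / 2)"
        by (rule powr_mult)
      also have "(1 / real n) powr (3 / 2) = real n powr (- 3 / 2)"
        using n by (simp add: powr_divide powr_minus field_simps)
      finally show ?thesis .
    qed
    also have "\<dots> \<le> C * real n powr (- 3 / 2)"
      using C by (rule mult_right_mono) simp
    finally show "(\<integral>z. \<bar>z r\<bar> ^ 3 \<partial>letter_step_law A n) \<le> C * real n powr (- 3 / 2)" .
  qed (simp add: letter_step_law_def)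
qed

lemma max_value_divide:
  assumes "q > 0"
  shows "max_value d n (\<lambda>l r. x l r / q) = max_value d n x / q"
proof -
  have "mono (\<lambda>v::real. v / q)"
    using assms by (intro monoI divide_right_mono) auto
  from mono_Max_commute[OF this, of "(\<lambda>k. path_value d n k x) ` paths d n"]
  show ?thesis
    by (simp add: max_value_def path_value_def image_image sum_divide_distrib)
qed

lemma max_value_cong:
  assumes "\<And>l r. l < n \<Longrightarrow> r \<in> {1..d} \<Longrightarrow> x l r = x' l r"
  shows "max_value d n x = max_value d n x'"
proof -
  have "path_value d n k x = path_value d n k x'" for k
    unfolding path_value_def using assms by (intro sum.cong refl) auto
  then show ?thesis by (simp add: max_value_def)
qed

lemma normalized_LI_eq_max_value:
  fixes x :: "nat \<Rightarrow> 'c::linorder"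
  assumes "finite A" "card A \<ge> 2" "n \<ge> 1" and x: "\<And>i. i \<in> {1..n} \<Longrightarrow> x i \<in> A"
  shows "(real (LI x n) - real n / real (card A)) / sqrt (2 * real n / real (card A))
    = max_value (card A - 1) n (\<lambda>l\<in>{..<n}. \<lambda>r\<in>{1..card A - 1}.
        letter_step A (x (Suc l)) r / sqrt (2 * real n / real (card A)))"
proof -
  let ?q = "sqrt (2 * real n / real (card A))"
  have m: "card A - 1 + 1 = card A" using assms(2) by simp
  have "real (LI x n) - real n / real (card A - 1 + 1)
    = max_value (card A - 1) n (\<lambda>l r. of_bool (letter_rank A (x (Suc l)) = r) - of_bool (letter_rank A (x (Suc l)) = Suc r))"
  proof (rule LI_eq_max_value)
    show "letter_rank A (x i) \<in> {1..card A - 1 + 1}" if "i \<in> {1..n}" for i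
      unfolding m using bij_betwE[OF bij_betw_letter_rank[OF assms(1)]] x[OF that] by blast
    show "x i \<le> x j \<longleftrightarrow> letter_rank A (x i) \<le> letter_rank A (x j)" if "i \<in> {1..n}" "j \<in> {1..n}" for i j
      using letter_rank_le_iff[OF assms(1) x[OF that(1)] x[OF that(2)]] by simp
  qed
  then have "(real (LI x n) - real n / real (card A)) / ?q
      = max_value (card A - 1) n (\<lambda>l r. letter_step A (x (Suc l)) r / ?q)"
    using assms(2,3) by (simp add: m letter_step_def max_value_divide)
  also have "\<dots> = max_value (card A - 1) n (\<lambda>l\<in>{..<n}. \<lambda>r\<in>{1..card A - 1}. letter_step A (x (Suc l)) r / ?q)"
    by (rule max_value_cong) auto
  finally show ?thesis .
qed

text \<open>The variables are indexed from \<open>1\<close> and the steps from \<open>0\<close>, hence the reindexing of the product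
  measure by \<^const>\<open>Suc\<close>.\<close>

lemma (in prob_space) letter_steps_iid:
  fixes X :: "nat \<Rightarrow> 'a \<Rightarrow> 'c::linorder"
  assumes "n \<ge> 1" and indep: "indep_vars (\<lambda>_. count_space A) X {1..}"
    and law: "\<And>k. k \<ge> 1 \<Longrightarrow> distr M (count_space A) (X k) = uniform_count_measure A"
  defines "d \<equiv> card A - 1" and "q \<equiv> sqrt (2 * real n / real (card A))"
  shows "(\<lambda>\<omega>. \<lambda>l\<in>{..<n}. \<lambda>r\<in>{1..d}. letter_step A (X (Suc l) \<omega>) r / q)
      \<in> measurable M (PiM {..<n} (\<lambda>_. PiM {1..d} (\<lambda>_. borel)))"
    and "distr M (PiM {..<n} (\<lambda>_. PiM {1..d} (\<lambda>_. borel)))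
      (\<lambda>\<omega>. \<lambda>l\<in>{..<n}. \<lambda>r\<in>{1..d}. letter_step A (X (Suc l) \<omega>) r / q)
    = PiM {..<n} (\<lambda>_. letter_step_law A n)"
proof -
  let ?S = "PiM {1..d} (\<lambda>_. borel :: real measure)"
  define g where "g c = (\<lambda>r\<in>{1..d}. letter_step A c r / q)" for c
  have X: "X k \<in> measurable M (count_space A)" if "k \<ge> 1" for k
    using indep that by (simp add: indep_vars_def)
  have g: "g \<in> measurable (count_space A) ?S"
    unfolding g_def[abs_def] by (intro measurable_restrict) simp
  have gX: "(\<lambda>\<omega>. g (X k \<omega>)) \<in> measurable M ?S" if "k \<ge> 1" for k
    using measurable_compose[OF X[OF that] g] .
  have dist: "distr M ?S (\<lambda>\<omega>. g (X k \<omega>)) = letter_step_law A n" if "k \<ge> 1" for k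
  proof -
    have "distr M ?S (\<lambda>\<omega>. g (X k \<omega>)) = distr (distr M (count_space A) (X k)) ?S g"
      using distr_distr[OF g X[OF that]] by (simp add: comp_def)
    then show ?thesis
      by (simp add: law[OF that] letter_step_law_def g_def[abs_def] d_def q_def)
  qed
  have prob: "prob_space (letter_step_law A n)"
    using dist[of 1] prob_space_distr[OF gX[of 1]] by simp
  have "indep_vars (\<lambda>_. ?S) (\<lambda>k \<omega>. g (X k \<omega>)) {1..n}"
    by (rule indep_vars_compose2[OF indep_vars_subset[OF indep] g]) auto
  then have "distr M (PiM {1..n} (\<lambda>_. ?S)) (\<lambda>\<omega>. \<lambda>k\<in>{1..n}. g (X k \<omega>)) = PiM {1..n} (\<lambda>k. distr M ?S (\<lambda>\<omega>. g (X k \<omega>)))"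
    using assms(1) gX by (subst (asm) indep_vars_iff_distr_eq_PiM') auto
  also have "\<dots> = PiM {1..n} (\<lambda>_. letter_step_law A n)"
    by (intro PiM_cong refl dist) auto
  finally have joint: "distr M (PiM {1..n} (\<lambda>_. ?S)) (\<lambda>\<omega>. \<lambda>k\<in>{1..n}. g (X k \<omega>)) = PiM {1..n} (\<lambda>_. letter_step_law A n)" .
  have shift: "(\<lambda>\<omega>. \<lambda>l\<in>{..<n}. \<omega> (Suc l)) \<in> measurable (PiM {1..n} (\<lambda>_. ?S)) (PiM {..<n} (\<lambda>_. ?S))"
    by (intro measurable_restrict measurable_component_singleton) auto
  have gXs: "(\<lambda>\<omega>. \<lambda>k\<in>{1..n}. g (X k \<omega>)) \<in> measurable M (PiM {1..n} (\<lambda>_. ?S))"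
    by (intro measurable_restrict gX) auto
  have W: "(\<lambda>\<omega>. \<lambda>l\<in>{..<n}. g (X (Suc l) \<omega>)) \<in> measurable M (PiM {..<n} (\<lambda>_. ?S))"
    by (intro measurable_restrict gX) auto
  then show "(\<lambda>\<omega>. \<lambda>l\<in>{..<n}. \<lambda>r\<in>{1..d}. letter_step A (X (Suc l) \<omega>) r / q)
      \<in> measurable M (PiM {..<n} (\<lambda>_. ?S))"
    by (simp add: g_def)
  have "distr M (PiM {..<n} (\<lambda>_. ?S)) (\<lambda>\<omega>. \<lambda>l\<in>{..<n}. g (X (Suc l) \<omega>))
    = distr (distr M (PiM {1..n} (\<lambda>_. ?S)) (\<lambda>\<omega>. \<lambda>k\<in>{1..n}. g (X k \<omega>))) (PiM {..<n} (\<lambda>_. ?S)) (\<lambda>\<omega>. \<lambda>l\<in>{..<n}. \<omega> (Suc l))"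
    unfolding distr_distr[OF shift gXs] by (intro distr_cong) (auto simp: restrict_def)
  also have "\<dots> = distr (PiM {1..n} (\<lambda>_. letter_step_law A n)) (PiM {..<n} (\<lambda>_. letter_step_law A n)) (\<lambda>\<omega>. \<lambda>l\<in>{..<n}. \<omega> (Suc l))"
    unfolding joint by (intro distr_cong sets_PiM_cong refl) (simp_all add: letter_step_law_def d_def)
  also have "\<dots> = PiM {..<n} (\<lambda>_. letter_step_law A n)"
    by (rule distr_PiM_reindex[where M = "\<lambda>_. letter_step_law A n" and f = Suc]) (auto simp: prob)
  finally show "distr M (PiM {..<n} (\<lambda>_. ?S)) (\<lambda>\<omega>. \<lambda>l\<in>{..<n}. \<lambda>r\<in>{1..d}. letter_step A (X (Suc l) \<omega>) r / q)
    = PiM {..<n} (\<lambda>_. letter_step_law A n)"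
    by (simp add: g_def)
qed

section \<open>Convergence in distribution\<close>

lemma (in prob_space) char_distr_eq_Complex:
  assumes Y [measurable]: "random_variable borel Y"
  shows "char (distr M borel Y) u
    = Complex (expectation (\<lambda>\<omega>. cos (u * Y \<omega> + 0))) (expectation (\<lambda>\<omega>. cos (u * Y \<omega> + - (pi / 2))))"
proof -
  have int: "complex_integrable M (\<lambda>\<omega>. iexp (u * Y \<omega>))"
    by (rule integrable_const_bound[of _ 1]) auto
  have "char (distr M borel Y) u = (CLINT \<omega>|M. iexp (u * Y \<omega>))"
    unfolding char_def by (subst integral_distr) auto
  moreover have "Re (CLINT \<omega>|M. iexp (u * Y \<omega>)) = expectation (\<lambda>\<omega>. cos (u * Y \<omega> + 0))"
    using integral_Re[OF int] by (simp add: Re_exp)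
  moreover have "Im (CLINT \<omega>|M. iexp (u * Y \<omega>)) = expectation (\<lambda>\<omega>. cos (u * Y \<omega> + - (pi / 2)))"
    using integral_Im[OF int] by (simp add: Im_exp cos_diff)
  ultimately show ?thesis
    by (simp add: complex_eq_iff)
qed

text \<open>The phases \<open>0\<close> and \<open>- \<pi> / 2\<close> give the real and the imaginary part of the characteristic function,
  and Levy's continuity theorem applies.\<close>

lemma weak_conv_m_if_cos_expectations:
  assumes M: "prob_space M" and N: "prob_space N"
    and Y: "\<And>n. Y n \<in> borel_measurable M" and Z: "Z \<in> borel_measurable N"
    and conv: "\<And>u \<theta>. (\<lambda>n. \<integral>\<omega>. cos (u * Y n \<omega> + \<theta>) \<partial>M) \<longlonglongrightarrow> (\<integral>\<omega>. cos (u * Z \<omega> + \<theta>) \<partial>N)"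
  shows "weak_conv_m (\<lambda>n. distr M borel (Y n)) (distr N borel Z)"
proof (rule levy_continuity)
  show "real_distribution (distr M borel (Y n))" for n
    by (rule prob_space.real_distribution_distr[OF M Y])
  show "real_distribution (distr N borel Z)"
    by (rule prob_space.real_distribution_distr[OF N Z])
  show "(\<lambda>n. char (distr M borel (Y n)) u) \<longlonglongrightarrow> char (distr N borel Z) u" for u
    unfolding prob_space.char_distr_eq_Complex[OF M Y] prob_space.char_distr_eq_Complex[OF N Z]
    by (intro tendsto_Complex conv)
qed

theorem proposition3p1:
  fixes \<P> :: "'a measure"
    and N :: "'b measure"
    and A :: "'c::linorder set"
    and m :: nat
    and X :: "nat \<Rightarrow> 'a \<Rightarrow> 'c"
    and B :: "nat \<Rightarrow> real \<Rightarrow> 'b \<Rightarrow> real"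
  assumes "m \<ge> 2"
    and "finite A" and "card A = m"
    and "prob_space \<P>"
    and "prob_space.indep_vars \<P> (\<lambda>_. count_space A) X {1..}"
    and "\<And>k. k \<ge> 1 \<Longrightarrow> distr \<P> (count_space A) (X k) = uniform_count_measure A"
    and "brownian_motion N (m - 1) tridiag B"
  shows "weak_conv_m
    (\<lambda>n. distr \<P> borel
       (\<lambda>\<omega>. (real (LI (\<lambda>k. X k \<omega>) n) - real n / real m) / sqrt (2 * real n / real m)))
    (distr N borel
       (\<lambda>\<omega>. - (1 / real m) * (\<Sum>i=1..m-1. real i * B i 1 \<omega>)
          + (SUP t\<in>ordered_times (m - 1). \<Sum>i=1..m-1. B i (t i) \<omega>)))"
proof -
  interpret P: prob_space \<P> by fact
  interpret W: brownian_motion N "m - 1" tridiag B by fact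
  define d where "d = m - 1"
  define Y where "Y n \<omega> = (real (LI (\<lambda>k. X k \<omega>) n) - real n / real m) / sqrt (2 * real n / real m)" for n \<omega>
  \<comment> \<open>\<open>C\<close> bounds the rescaled third moments of both the Brownian increments and the letter steps.\<close>
  define C where "C = 2 + (real m / 2) powr (3 / 2)"
  define steps where "steps n \<omega> = (\<lambda>l\<in>{..<n}. \<lambda>r\<in>{1..d}. letter_step A (X (Suc l) \<omega>) r / sqrt (2 * real n / real m))"
    for n \<omega>
  have steps_meas: "steps n \<in> measurable \<P> (PiM {..<n} (\<lambda>_. PiM {1..d} (\<lambda>_. borel)))"
    and steps_law: "distr \<P> (PiM {..<n} (\<lambda>_. PiM {1..d} (\<lambda>_. borel))) (steps n) = PiM {..<n} (\<lambda>_. letter_step_law A n)"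
    if n: "n \<ge> 1" for n
    using P.letter_steps_iid[OF n assms(5)] assms(6) unfolding steps_def[abs_def] d_def assms(3)[symmetric] by blast+
  have m: "real (m - 1 + 1) = real m" using assms(1) by simp
  have X: "X k \<omega> \<in> A" if "k \<ge> 1" "\<omega> \<in> space \<P>" for k \<omega>
  proof -
    have "X k \<in> measurable \<P> (count_space A)"
      using assms(5) that(1) by (simp add: P.indep_vars_def)
    from measurable_space[OF this that(2)] show ?thesis by simp
  qed
  have Y_eq: "Y n \<omega> = max_value d n (steps n \<omega>)" if "n \<ge> 1" "\<omega> \<in> space \<P>" for n \<omega>
    using normalized_LI_eq_max_value[OF assms(2) _ that(1), of "\<lambda>k. X k \<omega>"] X that(2) assms(1)
    unfolding Y_def steps_def d_def assms(3) by simp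
  have max_meas: "(\<lambda>\<omega>. max_value d n (steps n \<omega>)) \<in> borel_measurable \<P>" if "n \<ge> 1" for n
    by (rule measurable_compose[OF steps_meas[OF that] measurable_max_value])
  have Y_meas: "Y n \<in> borel_measurable \<P>" for n
  proof (cases "n = 0")
    case True
    then show ?thesis by (simp add: Y_def[abs_def])
  next
    case False
    then have "Y n \<in> borel_measurable \<P> \<longleftrightarrow> (\<lambda>\<omega>. max_value d n (steps n \<omega>)) \<in> borel_measurable \<P>"
      using Y_eq by (intro measurable_cong) auto
    then show ?thesis using max_meas False by simp
  qed
  have EY: "(\<integral>\<omega>. cos (u * Y n \<omega> + \<theta>) \<partial>\<P>)
      = (\<integral>x. cos (u * max_value d n x + \<theta>) \<partial>PiM {..<n} (\<lambda>_. letter_step_law A n))" if n: "n \<ge> 1" for n u \<theta>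
  proof -
    have "(\<lambda>x. cos (u * max_value d n x + \<theta>)) \<in> borel_measurable (PiM {..<n} (\<lambda>_. PiM {1..d} (\<lambda>_. borel)))"
      by measurable
    from integral_distr[OF steps_meas[OF n] this]
    have "(\<integral>x. cos (u * max_value d n x + \<theta>) \<partial>PiM {..<n} (\<lambda>_. letter_step_law A n))
        = (\<integral>\<omega>. cos (u * max_value d n (steps n \<omega>) + \<theta>) \<partial>\<P>)"
      unfolding steps_law[OF n] .
    also have "\<dots> = (\<integral>\<omega>. cos (u * Y n \<omega> + \<theta>) \<partial>\<P>)"
      using Y_eq[OF n] by (intro Bochner_Integration.integral_cong) auto
    finally show ?thesis by simp
  qed
  have conv: "(\<lambda>n. \<integral>\<omega>. cos (u * Y n \<omega> + \<theta>) \<partial>\<P>) \<longlonglongrightarrow> (\<integral>\<omega>. cos (u * W.limit_functional \<omega> + \<theta>) \<partial>N)" for u \<theta>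
  proof -
    have letters: "step_law d (\<lambda>r s. tridiag r s / real n) (C * real n powr (- 3 / 2)) (letter_step_law A n)"
      if "n \<ge> 1" for n
      unfolding d_def assms(3)[symmetric]
      by (rule step_law_letter_step_law) (use assms that in \<open>auto simp: C_def\<close>)
    have brownian: "step_law d (\<lambda>r s. tridiag r s / real n) (C * real n powr (- 3 / 2)) (W.increment_law n)"
      if "n \<ge> 1" for n
    proof -
      have "step_law d (\<lambda>r s. tridiag r s / real n) (2 * real n powr (- 3 / 2)) (W.increment_law n)"
        unfolding d_def by (rule W.step_law_increment_law[OF _ that]) (simp add: tridiag_def)
      then show ?thesis
        by (rule step_law_mono) (auto simp: C_def intro!: mult_right_mono)
    qed
    have "(\<lambda>n. (\<integral>x. cos (u * max_value d n x + \<theta>) \<partial>PiM {..<n} (\<lambda>_. letter_step_law A n))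
        - (\<integral>x. cos (u * max_value d n x + \<theta>) \<partial>PiM {..<n} (\<lambda>_. W.increment_law n))) \<longlonglongrightarrow> 0"
      by (rule max_value_comparison_tendsto[OF letters brownian])
    from tendsto_add[OF this W.expectation_cos_grid_tendsto[of u \<theta>]]
    have "(\<lambda>n. (\<integral>x. cos (u * max_value d n x + \<theta>) \<partial>PiM {..<n} (\<lambda>_. letter_step_law A n))
        - (\<integral>x. cos (u * max_value d n x + \<theta>) \<partial>PiM {..<n} (\<lambda>_. W.increment_law n))
        + (\<integral>\<omega>. cos (u * W.grid_functional n \<omega> + \<theta>) \<partial>N)) \<longlonglongrightarrow> (\<integral>\<omega>. cos (u * W.limit_functional \<omega> + \<theta>) \<partial>N)"
      by simp
    then show ?thesis
    proof (rule Lim_transform_eventually)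
      show "\<forall>\<^sub>F n in sequentially. (\<integral>x. cos (u * max_value d n x + \<theta>) \<partial>PiM {..<n} (\<lambda>_. letter_step_law A n))
        - (\<integral>x. cos (u * max_value d n x + \<theta>) \<partial>PiM {..<n} (\<lambda>_. W.increment_law n))
        + (\<integral>\<omega>. cos (u * W.grid_functional n \<omega> + \<theta>) \<partial>N) = (\<integral>\<omega>. cos (u * Y n \<omega> + \<theta>) \<partial>\<P>)"
        using eventually_ge_at_top[of 1]
      proof eventually_elim
        case (elim n)
        have "(\<integral>x. cos (u * max_value d n x + \<theta>) \<partial>PiM {..<n} (\<lambda>_. W.increment_law n))
          = (\<integral>\<omega>. cos (u * W.grid_functional n \<omega> + \<theta>) \<partial>N)"
          unfolding d_def by (rule W.expectation_increment_law[OF elim, of "\<lambda>v. cos (u * v + \<theta>)"]) measurable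
        then show ?case by (simp add: EY[OF elim])
      qed
    qed
  qed
  have "weak_conv_m (\<lambda>n. distr \<P> borel (Y n)) (distr N borel W.limit_functional)"
    by (rule weak_conv_m_if_cos_expectations[OF assms(4) W.prob_space_axioms Y_meas W.measurable_limit_functional conv])
  then show ?thesis
    unfolding Y_def[abs_def] W.limit_functional_def[abs_def] m .
qed

end
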